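(* Given a frequency $\lambda$ and a $\lambda$-Dirichlet group $(G,\beta)$, it is in general not true that each $f\in H_1^\lambda(G)$ has an almost everywhere $(e^\lambda,1)$-Riesz summable Fourier series. Precisely, both of the following are counterexamples, i.e. in each of these two cases there is $f\in H_1^\lambda(G)$ whose Fourier series fails to be $(e^\lambda,1)$-Riesz summable almost everywhere on $G$: (i) $\lambda=(n)_{n\ge0}$ and $(\mathbb T,\beta_{\mathbb T})$; (ii) $\lambda=(\log n)_{n\ge1}$ and $(\mathbb T^\infty,\beta_{\mathbb T^\infty})$.
   Context: A frequency is a strictly increasing, unbounded sequence $\lambda=(\lambda_n)$ of non-negative real numbers. A Dirichlet group $(G,\beta)$ is a compact abelian group $G$ together with a continuous homomorphism $\beta:(\mathbb R,+)\to G$ with dense range; it is a $\lambda$-Dirichlet group if for every $n$ there is a (then unique) character $h_{\lambda_n}\in\widehat G$ with $h_{\lambda_n}(\beta(t))=e^{-i\lambda_nt}$ for all $t\in\mathbb R$. With $m$ the normalized Haar measure and $\widehat f(\gamma)=\int_Gf\,\overline\gamma\,dm$, $H_1^\lambda(G)$ is the space of all $f\in L_1(G)$ such that $\widehat f(\gamma)\neq0$ implies $\gamma=h_{\lambda_n}$ for some $n$. Put $e^\lambda=(e^{\lambda_n})$. The Fourier series of $f\in H_1^\lambda(G)$ is $(e^\lambda,1)$-Riesz summable at $\omega\in G$ if the limit $\lim_{x\to\infty}\sum_{e^{\lambda_n}<x}\widehat f(h_{\lambda_n})\big(1-\frac{e^{\lambda_n}}{x}\big)h_{\lambda_n}(\omega)$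 exists. In (i), $\beta_{\mathbb T}(t)=e^{-it}$, so $h_n(z)=z^n$ and $H_1^{(n)}(\mathbb T)=H_1(\mathbb T)$ is the classical Hardy space. In (ii), $\mathbb T^\infty=\prod_{k=1}^\infty\mathbb T$ and $\beta_{\mathbb T^\infty}(t)=(p_k^{-it})_k$ with $p_k$ the $k$-th prime, so $h_{\log n}(z)=z^\alpha$ whenever $n=\prod_kp_k^{\alpha_k}$. *)

theory Defs
  imports "HOL-Analysis.Analysis" "HOL-Algebra.Product_Groups" "HOL-Library.Infinite_Set"
begin

definition frequency :: "(nat \<Rightarrow> real) \<Rightarrow> bool" where
  "frequency lam \<longleftrightarrow> strict_mono lam \<and> (\<forall>n. 0 \<le> lam n) \<and> \<not> bdd_above (range lam)"

text \<open>A compact abelian (Hausdorff) group lives on a subset of a Hausdorff type and carries the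
  subspace topology.\<close>

locale compact_abelian_group = comm_group G
  for G :: "('a::t2_space, 'b) monoid_scheme" (structure) +
  assumes compact_carrier: "compact (carrier G)"
    and continuous_mult: "continuous_on (carrier G \<times> carrier G) (\<lambda>(x, y). x \<otimes> y)"
    and continuous_inv: "continuous_on (carrier G) (\<lambda>x. inv x)"

text \<open>The invariant Radon probability measures on the Borel sets of \<open>G\<close>. Inner regularity on all
  Borel sets is what makes such a measure unique when \<open>G\<close> is not second countable.\<close>

definition is_normalized_haar ::
    "('a::t2_space, 'b) monoid_scheme \<Rightarrow> 'a measure \<Rightarrow> bool" where
  "is_normalized_haar G m \<longleftrightarrow>
     sets m = sets (restrict_space borel (carrier G)) \<and>
     emeasure m (carrier G) = 1 \<and>
     (\<forall>a\<in>carrier G. \<forall>A\<in>sets m. emeasure m ((\<lambda>x. a \<otimes>\<^bsub>G\<^esub> x) ` A) = emeasure m A) \<and>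
     (\<forall>A\<in>sets m. emeasure m A = (SUP K\<in>{K. K \<subseteq> A \<and> compact K}. emeasure m K))"

definition haar_measure :: "('a::t2_space, 'b) monoid_scheme \<Rightarrow> 'a measure" where
  "haar_measure G = (THE m. is_normalized_haar G m)"

definition circle_group :: "complex monoid" where
  "circle_group = \<lparr>carrier = sphere 0 1, monoid.mult = (*), one = 1\<rparr>"

text \<open>Characters are taken extensional, so that they are equal as soon as they agree on the
  carrier.\<close>

definition characters :: "('a::t2_space, 'b) monoid_scheme \<Rightarrow> ('a \<Rightarrow> complex) set" where
  "characters G =
     {\<gamma> \<in> hom G circle_group. continuous_on (carrier G) \<gamma> \<and> \<gamma> \<in> extensional (carrier G)}"

locale dirichlet_group = compact_abelian_group G
  for G :: "('a::t2_space, 'b) monoid_scheme" (structure) and \<beta> :: "real \<Rightarrow> 'a" +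
  assumes \<beta>_closed: "\<beta> t \<in> carrier G"
    and \<beta>_add: "\<beta> (s + t) = \<beta> s \<otimes> \<beta> t"
    and \<beta>_continuous: "continuous_on UNIV \<beta>"
    and \<beta>_dense: "carrier G \<subseteq> closure (range \<beta>)"

definition represents_frequency ::
    "(real \<Rightarrow> 'a) \<Rightarrow> real \<Rightarrow> ('a \<Rightarrow> complex) \<Rightarrow> bool" where
  "represents_frequency \<beta> x \<gamma> \<longleftrightarrow> (\<forall>t. \<gamma> (\<beta> t) = exp (- (\<i> * of_real x * of_real t)))"

locale lambda_dirichlet_group = dirichlet_group G \<beta>
  for lam :: "nat \<Rightarrow> real" and G :: "('a::t2_space, 'b) monoid_scheme" (structure)
    and \<beta> :: "real \<Rightarrow> 'a" +
  assumes character_exists: "\<exists>\<gamma>\<in>characters G. represents_frequency \<beta> (lam n) \<gamma>"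

definition freq_character ::
    "('a::t2_space, 'b) monoid_scheme \<Rightarrow> (real \<Rightarrow> 'a) \<Rightarrow> real \<Rightarrow> 'a \<Rightarrow> complex" where
  "freq_character G \<beta> x = (THE \<gamma>. \<gamma> \<in> characters G \<and> represents_frequency \<beta> x \<gamma>)"

definition fourier_coeff ::
    "('a::t2_space, 'b) monoid_scheme \<Rightarrow> ('a \<Rightarrow> complex) \<Rightarrow> ('a \<Rightarrow> complex) \<Rightarrow> complex" where
  "fourier_coeff G f \<gamma> = (LINT \<omega>|haar_measure G. f \<omega> * cnj (\<gamma> \<omega>))"

text \<open>Elements of the Hardy space are represented by integrable functions rather than by classes
  modulo null sets.\<close>

definition hardy_H1 ::
    "(nat \<Rightarrow> real) \<Rightarrow> ('a::t2_space, 'b) monoid_scheme \<Rightarrow> (real \<Rightarrow> 'a) \<Rightarrow> ('a \<Rightarrow> complex) set" where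
  "hardy_H1 lam G \<beta> =
     {f. integrable (haar_measure G) f \<and>
         (\<forall>\<gamma>\<in>characters G. fourier_coeff G f \<gamma> \<noteq> 0 \<longrightarrow> (\<exists>n. \<gamma> = freq_character G \<beta> (lam n)))}"

definition riesz_mean ::
    "(nat \<Rightarrow> real) \<Rightarrow> ('a::t2_space, 'b) monoid_scheme \<Rightarrow> (real \<Rightarrow> 'a) \<Rightarrow> ('a \<Rightarrow> complex)
       \<Rightarrow> real \<Rightarrow> 'a \<Rightarrow> complex" where
  "riesz_mean lam G \<beta> f x \<omega> =
     (\<Sum>n | exp (lam n) < x.
        fourier_coeff G f (freq_character G \<beta> (lam n)) * of_real (1 - exp (lam n) / x) *
        freq_character G \<beta> (lam n) \<omega>)"

definition riesz_summable_at ::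
    "(nat \<Rightarrow> real) \<Rightarrow> ('a::t2_space, 'b) monoid_scheme \<Rightarrow> (real \<Rightarrow> 'a) \<Rightarrow> ('a \<Rightarrow> complex)
       \<Rightarrow> 'a \<Rightarrow> bool" where
  "riesz_summable_at lam G \<beta> f \<omega> \<longleftrightarrow> (\<exists>l. ((\<lambda>x. riesz_mean lam G \<beta> f x \<omega>) \<longlongrightarrow> l) at_top)"

definition \<beta>_circle :: "real \<Rightarrow> complex" where
  "\<beta>_circle t = exp (- (\<i> * of_real t))"

text \<open>The index set is \<open>{0, 1, \<dots>}\<close> instead of \<open>{1, 2, \<dots>}\<close>. The type \<open>nat \<Rightarrow> complex\<close> has the
  product topology.\<close>

definition torus_group :: "(nat \<Rightarrow> complex) monoid" where
  "torus_group = product_group UNIV (\<lambda>_. circle_group)"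

definition nth_prime :: "nat \<Rightarrow> nat" where
  "nth_prime k = enumerate {p. prime p} k"

definition \<beta>_torus :: "real \<Rightarrow> nat \<Rightarrow> complex" where
  "\<beta>_torus t = (\<lambda>k. of_nat (nth_prime k) powr (- (\<i> * of_real t)))"

end

theory Submission
  imports
    Defs
    "HOL-Computational_Algebra.Polynomial"
    "HOL-Computational_Algebra.Primes"
    "HOL-Probability.Infinite_Product_Measure"
    "HOL-Analysis.Kronecker_Approximation_Theorem"
begin

text \<open>If the frequencies contain a progression \<open>0, c, 2 c, \<dots>\<close> and \<open>f\<close> has its spectrum there,
  the first order Riesz means at the points \<open>exp (c K)\<close> determine the partial sums of the
  power series in the character \<open>h\<close> of frequency \<open>c\<close>, so that it suffices to find \<open>f\<close>
  for which these partial sums diverge on a set of positive measure. Since \<open>h\<close> maps onto the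
  circle, this is a question on the classical Hardy space, answered by Kolmogorov's construction:
  an average of unit point masses near the \<open>n\<close>-th roots of unity, suitably perturbed, has some
  block of Fourier coefficients whose sum is of order \<open>log n\<close>, at all points of a set whose
  measure does not depend on \<open>n\<close>. Convolution with an analytic kernel whose coefficients are 1 on a
  long window turns the point masses into polynomials bounded in \<open>H\<^sub>1\<close>, and a gliding hump
  combines these into \<open>f\<close>. All integrals are computed on the group itself, from the orthogonality
  of characters and the translation invariance of Haar measure.\<close>

text \<open>The Riesz means do not smooth here because \<open>exp (c k)\<close> grows geometrically:
  with \<open>q = exp c\<close> the weight of term \<open>k\<close> is \<open>1 - q^(k-K)\<close>,
  so only the last few terms before \<open>K\<close> are damped. A block of the \<open>n\<close>-th
  polynomial, evaluated at \<open>z\<close>, telescopes to the difference of two boundary sums of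
  \<open>phase_j * c_j / n\<close>, where \<open>c_j = 1 / (w_j z - 1)\<close> and
  \<open>w_j\<close> runs through the perturbed roots. The average of the \<open>|c_j| / n\<close>
  over the relevant scale is harmonic, of order \<open>log n\<close>, but both boundary sums may be
  large and cancel. Hence the two ends of the block are chosen separately, depending on
  \<open>z\<close>: at one end the phases are aligned up to a factor 2, at the other they give
  square root cancellation. The bound \<open>|c_j| \<le> n\<close> makes the second end of order
  only \<open>sqrt (log n)\<close>. Every phase pattern in use occurs at some exponent
  \<open>n m\<close> with \<open>m < 4^n\<close>, and the pattern repeats after
  \<open>K = n 4^n\<close> exponents. So the window from \<open>K\<close> to \<open>2 K\<close>
  contains all the blocks needed, and moving there from 0, as an analytic kernel requires, costs
  nothing.\<close>

subsection \<open>Prescribing the values of characters at perturbed roots of unity\<close>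

text \<open>Choosing the base-4 digits of \<open>m\<close> one after the other, the \<open>j\<close>-th phase can be
  turned by any fourth root of unity without disturbing the earlier ones. This replaces the appeal
  to Kronecker's theorem in Kolmogorov's construction.\<close>

definition digit_phase :: "nat \<Rightarrow> nat \<Rightarrow> complex" where
  "digit_phase m j = cis (2 * pi * real m / 4 ^ Suc j)"

lemma digit_phase_add_lower:
  assumes "j < n"
  shows "digit_phase (m + d * 4 ^ n) j = digit_phase m j"
proof -
  obtain r where r: "n = Suc j + r" using assms less_iff_Suc_add by auto
  have "2 * pi * real (m + d * 4 ^ n) / 4 ^ Suc j = 2 * pi * real m / 4 ^ Suc j + 2 * pi * real (d * 4 ^ r)"
    by (simp add: r field_simps power_add)
  then have "digit_phase (m + d * 4 ^ n) j = digit_phase m j * cis (2 * pi * real (d * 4 ^ r))"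
    by (simp only: digit_phase_def cis_mult)
  also have "cis (2 * pi * real (d * 4 ^ r)) = 1"
    by (rule cis_multiple_2pi) auto
  finally show ?thesis by simp
qed

lemma digit_phase_add_top: "digit_phase (m + d * 4 ^ n) n = \<i> ^ d * digit_phase m n"
proof -
  have "2 * pi * real (m + d * 4 ^ n) / 4 ^ Suc n = real d * (pi / 2) + 2 * pi * real m / 4 ^ Suc n"
    by (simp add: field_simps)
  then have "digit_phase (m + d * 4 ^ n) n = cis (real d * (pi / 2)) * digit_phase m n"
    by (simp only: digit_phase_def cis_mult)
  also have "cis (real d * (pi / 2)) = \<i> ^ d"
    by (metis Complex.DeMoivre cis_pi_half)
  finally show ?thesis .
qed

lemma norm_digit_phase [simp]: "norm (digit_phase m j) = 1"
  by (simp add: digit_phase_def)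

text \<open>The four turns have real parts \<open>Re w\<close>, \<open>- Im w\<close>,
  \<open>- Re w\<close>, \<open>Im w\<close>, and \<open>|Re w| + |Im w|\<close> is at least
  \<open>norm w\<close>.\<close>

lemma ex_quarter_turn_aligned: "\<exists>d<4. norm w / 2 \<le> Re (\<i> ^ d * w)"
proof -
  have "norm w \<le> \<bar>Re w\<bar> + \<bar>Im w\<bar>" by (rule cmod_le)
  then consider "norm w / 2 \<le> Re w" | "norm w / 2 \<le> - Im w" | "norm w / 2 \<le> - Re w" | "norm w / 2 \<le> Im w"
    by linarith
  then show ?thesis
  proof cases
    case 1 then show ?thesis by (intro exI[of _ 0]) auto
  next
    case 2 then show ?thesis by (intro exI[of _ 1]) auto
  next
    case 3 then show ?thesis by (intro exI[of _ 2]) auto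
  next
    case 4 then show ?thesis by (intro exI[of _ 3]) (auto simp: power3_eq_cube)
  qed
qed

lemma digit_bound: "m < 4 ^ n \<Longrightarrow> d < 4 \<Longrightarrow> m + d * 4 ^ n < (4::nat) ^ Suc n"
proof -
  assume "m < 4 ^ n" "d < 4"
  then have "d * 4 ^ n \<le> 3 * (4::nat) ^ n" by (intro mult_right_mono) auto
  with \<open>m < 4 ^ n\<close> have "m + d * 4 ^ n < 4 ^ n + 3 * 4 ^ n" by (rule add_less_le_mono)
  then show ?thesis by simp
qed

text \<open>Greedy choice of digits: the new digit turns the new summand towards the positive real
  axis and leaves the earlier summands alone. This supplies the large end of a block.\<close>

lemma ex_aligned_phases:
  fixes c :: "nat \<Rightarrow> complex"
  shows "\<exists>m<4 ^ n. (\<Sum>j<n. norm (c j)) / 2 \<le> Re (\<Sum>j<n. digit_phase m j * c j)"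
proof (induction n)
  case 0
  then show ?case by auto
next
  case (Suc n)
  then obtain m where m: "m < 4 ^ n" "(\<Sum>j<n. norm (c j)) / 2 \<le> Re (\<Sum>j<n. digit_phase m j * c j)"
    by blast
  obtain d where d: "d < 4" "norm (digit_phase m n * c n) / 2 \<le> Re (\<i> ^ d * (digit_phase m n * c n))"
    using ex_quarter_turn_aligned by blast
  have "(\<Sum>j<n. digit_phase (m + d * 4 ^ n) j * c j) = (\<Sum>j<n. digit_phase m j * c j)"
    by (intro sum.cong) (auto simp: digit_phase_add_lower)
  then show ?case
    using m d by (intro exI[of _ "m + d * 4 ^ n"])
      (auto simp: digit_phase_add_top norm_mult mult.assoc intro: digit_bound[simplified])
qed

text \<open>By the parallelogram law one of the two signs of the new summand does not exceed the sum
  of squares, so the digits 0 and 2 suffice. This supplies the small end of a block.\<close>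

lemma ex_cancelling_phases:
  fixes c :: "nat \<Rightarrow> complex"
  shows "\<exists>m<4 ^ n. (norm (\<Sum>j<n. digit_phase m j * c j))\<^sup>2 \<le> (\<Sum>j<n. (norm (c j))\<^sup>2)"
proof (induction n)
  case 0
  then show ?case by auto
next
  case (Suc n)
  then obtain m where m: "m < 4 ^ n"
    "(norm (\<Sum>j<n. digit_phase m j * c j))\<^sup>2 \<le> (\<Sum>j<n. (norm (c j))\<^sup>2)"
    by blast
  let ?S = "\<Sum>j<n. digit_phase m j * c j" and ?w = "digit_phase m n * c n"
  have "(norm (?S + ?w))\<^sup>2 + (norm (?S - ?w))\<^sup>2 = 2 * (norm ?S)\<^sup>2 + 2 * (norm ?w)\<^sup>2"
    by (simp only: cmod_power2) (simp add: power2_eq_square algebra_simps)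
  then have "(norm (?S + ?w))\<^sup>2 \<le> (norm ?S)\<^sup>2 + (norm ?w)\<^sup>2 \<or> (norm (?S - ?w))\<^sup>2 \<le> (norm ?S)\<^sup>2 + (norm ?w)\<^sup>2"
    by linarith
  then obtain d where d: "d < 4" "(norm (?S + \<i> ^ d * ?w))\<^sup>2 \<le> (norm ?S)\<^sup>2 + (norm ?w)\<^sup>2"
  proof
    assume "(norm (?S + ?w))\<^sup>2 \<le> (norm ?S)\<^sup>2 + (norm ?w)\<^sup>2"
    then show ?thesis by (intro that[of 0]) auto
  next
    assume "(norm (?S - ?w))\<^sup>2 \<le> (norm ?S)\<^sup>2 + (norm ?w)\<^sup>2"
    then show ?thesis by (intro that[of 2]) auto
  qed
  have "(\<Sum>j<n. digit_phase (m + d * 4 ^ n) j * c j) = ?S"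
    by (intro sum.cong) (auto simp: digit_phase_add_lower)
  then show ?case
    using m d by (intro exI[of _ "m + d * 4 ^ n"])
      (auto simp: digit_phase_add_top norm_mult mult.assoc intro: digit_bound[simplified])
qed

text \<open>The perturbation of the \<open>n\<close>-th roots of unity is such that their \<open>(n m)\<close>-th
  powers are the phases above.\<close>

definition perturbed_root :: "nat \<Rightarrow> nat \<Rightarrow> complex" where
  "perturbed_root n j = cis (2 * pi * ((real j + 1 / 4 ^ Suc j) / real n))"

lemma norm_perturbed_root [simp]: "norm (perturbed_root n j) = 1"
  by (simp add: perturbed_root_def)

lemma perturbed_root_power:
  assumes "n > 0"
  shows "perturbed_root n j ^ (n * m) = digit_phase m j"
proof -
  have "real (n * m) * (2 * pi * ((real j + 1 / 4 ^ Suc j) / real n)) =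
        2 * pi * real (m * j) + 2 * pi * real m / 4 ^ Suc j"
    using assms by (simp add: field_simps)
  then have "perturbed_root n j ^ (n * m) = cis (2 * pi * real (m * j)) * digit_phase m j"
    by (simp only: perturbed_root_def digit_phase_def Complex.DeMoivre cis_mult)
  also have "cis (2 * pi * real (m * j)) = 1"
    by (rule cis_multiple_2pi) auto
  finally show ?thesis by simp
qed

text \<open>All digits of \<open>4 ^ n\<close> below position \<open>n\<close> are 0, so its phases
  are those of 0. This lets blocks start at \<open>n * 4 ^ n\<close> with unchanged phases.\<close>

lemma perturbed_root_period:
  assumes "j < n"
  shows "perturbed_root n j ^ (n * 4 ^ n) = 1"
  using assms digit_phase_add_lower[OF assms, of 0 1]
  by (simp add: perturbed_root_power) (simp add: digit_phase_def)

subsection \<open>The kernel\<close>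

text \<open>On the circle this is a Dirichlet kernel up to a unimodular factor, shifted to
  nonnegative frequencies.\<close>

definition geom_poly :: "nat \<Rightarrow> complex poly" where
  "geom_poly N = (\<Sum>l<N. monom 1 l)"

text \<open>A de la Vallee Poussin kernel, shifted so as to be analytic: its coefficients are 1 on a
  long window and its \<open>L\<^sub>1\<close> norm is bounded, by AM-GM and orthogonality.\<close>

definition vp_poly :: "nat \<Rightarrow> complex poly" where
  "vp_poly K = smult (1 / of_nat K) (geom_poly K * geom_poly (2 * K))"

lemma coeff_geom_poly: "coeff (geom_poly N) l = (if l < N then 1 else 0)"
  by (auto simp: geom_poly_def coeff_sum)

lemma poly_geom_poly: "poly (geom_poly N) z = (\<Sum>l<N. z ^ l)"
  by (simp add: geom_poly_def poly_sum poly_monom)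

text \<open>The coefficients of the product form a trapezoid. On its plateau each of the
  \<open>K\<close> monomials of the shorter factor has exactly one partner, and the factor
  \<open>1 / K\<close> normalizes the height to 1.\<close>

lemma coeff_vp_poly:
  assumes "K > 0" "K \<le> l" "l < 2 * K"
  shows "coeff (vp_poly K) l = 1"
proof -
  have "coeff (geom_poly K * geom_poly (2 * K)) l = (\<Sum>i\<le>l. if i < K then 1 else 0)"
    unfolding coeff_mult using assms by (intro sum.cong) (auto simp: coeff_geom_poly)
  also have "\<dots> = (\<Sum>i<K. 1)"
    using assms by (intro sum.mono_neutral_cong_right) auto
  finally show ?thesis using assms by (simp add: vp_poly_def)
qed

section \<open>Kolmogorov's polynomials and their large blocks\<close>

text \<open>The convolution of the kernel with the measure that has mass \<open>1 / n\<close> at the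
  inverse of each perturbed root. Composition with a linear polynomial is the rotation and
  multiplies coefficient \<open>l\<close> by the \<open>l\<close>-th power of the root.\<close>

definition kolmogorov_poly :: "nat \<Rightarrow> complex poly" where
  "kolmogorov_poly n = smult (1 / of_nat n)
     (\<Sum>j<n. pcompose (vp_poly (n * 4 ^ n)) [:0, perturbed_root n j:])"

lemma poly_kolmogorov_poly:
  "poly (kolmogorov_poly n) z =
     (\<Sum>j<n. poly (vp_poly (n * 4 ^ n)) (perturbed_root n j * z)) / of_nat n"
  by (simp add: kolmogorov_poly_def poly_sum poly_pcompose mult.commute)

lemma coeff_kolmogorov_poly:
  assumes "n > 0" "n * 4 ^ n \<le> l" "l < 2 * (n * 4 ^ n)"
  shows "coeff (kolmogorov_poly n) l = (\<Sum>j<n. perturbed_root n j ^ l) / of_nat n"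
  using assms by (simp add: kolmogorov_poly_def coeff_sum coeff_pcompose_linear coeff_vp_poly)

text \<open>The condition on \<open>z ^ n\<close> keeps \<open>z\<close> away from all the poles \<open>1 / w\<close>, where \<open>w\<close> is a
  perturbed root; the condition on \<open>z\<close> itself leaves enough poles on one side of \<open>z\<close> for a
  harmonic sum to appear in \<open>sum_pole_ge\<close>.\<close>

definition kolmogorov_set :: "nat \<Rightarrow> complex set" where
  "kolmogorov_set n = {z \<in> sphere 0 1. 0 \<le> Im z \<and> Re (z ^ n) \<le> 0 \<and> 0 \<le> Im (z ^ n)}"

lemma norm_power_diff_1_le:
  fixes y :: complex
  assumes "norm y = 1"
  shows "norm (y ^ n - 1) \<le> real n * norm (y - 1)"
proof -
  have "norm (y ^ n - 1) = norm (y - 1) * norm (\<Sum>i<n. y ^ i)"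
    by (simp add: power_diff_1_eq norm_mult)
  also have "norm (\<Sum>i<n. y ^ i) \<le> (\<Sum>i<n. 1)"
    using assms by (intro sum_norm_le) (simp add: norm_power)
  finally show ?thesis by (metis mult.commute norm_ge_zero mult_left_mono sum_constant card_lessThan mult.right_neutral)
qed

text \<open>The \<open>n\<close>-th power of \<open>perturbed_root n j * z\<close> is
  \<open>digit_phase 1 j * z ^ n\<close>, a product of a point in the first quadrant and one in the
  second. Its real part is therefore at most 0 and its distance from 1 at least 1; taking the
  \<open>n\<close>-th power enlarges the distance from 1 at most \<open>n\<close> times.\<close>

lemma perturbed_root_away_from_pole:
  assumes "n > 0" "z \<in> kolmogorov_set n"
  shows "1 \<le> real n * norm (perturbed_root n j * z - 1)"
proof -
  let ?t = "2 * pi * real 1 / 4 ^ Suc j"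
  have z: "norm z = 1" "Re (z ^ n) \<le> 0" "0 \<le> Im (z ^ n)"
    using assms by (auto simp: kolmogorov_set_def)
  have "?t \<le> pi / 2"
    using one_le_power[of "4::real" j] by (simp add: field_simps)
  moreover have "0 \<le> ?t" by simp
  ultimately have t: "0 \<le> cos ?t" "0 \<le> sin ?t"
    by (intro cos_ge_zero sin_ge_zero; linarith)+
  have "(perturbed_root n j * z) ^ n = digit_phase 1 j * z ^ n"
    using perturbed_root_power[OF assms(1), of j 1] by (simp add: power_mult_distrib)
  then have "Re ((perturbed_root n j * z) ^ n) = cos ?t * Re (z ^ n) - sin ?t * Im (z ^ n)"
    by (simp add: digit_phase_def)
  also have "\<dots> \<le> 0"
    using mult_nonneg_nonpos[OF t(1) z(2)] mult_nonneg_nonneg[OF t(2) z(3)] by linarith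
  finally have "1 \<le> \<bar>Re ((perturbed_root n j * z) ^ n - 1)\<bar>" by simp
  also have "\<dots> \<le> norm ((perturbed_root n j * z) ^ n - 1)" by (rule abs_Re_le_cmod)
  also have "\<dots> \<le> real n * norm (perturbed_root n j * z - 1)"
    using z by (intro norm_power_diff_1_le) (simp add: norm_mult)
  finally show ?thesis .
qed

lemma norm_cis_diff_1_le: "norm (cis t - 1) \<le> \<bar>t\<bar>"
  using dist_exp_i_1[of t] abs_sin_x_le_abs_x[of "t/2"] by (simp add: dist_norm cis_conv_exp)

text \<open>Writing \<open>z = cis (2 * pi * x)\<close>, the roots closest to \<open>1 / z\<close>
  have index near \<open>n (1 - x)\<close>. Since \<open>x \<le> 1 / 2\<close>, at least
  \<open>p\<close> indices lie below it, and the \<open>l\<close>-th of them has distance at most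
  \<open>2 pi (l + 1) / n\<close>, which yields a harmonic sum.\<close>

lemma sum_pole_ge:
  assumes "p > 0" "n = 2 * p" "z \<in> kolmogorov_set n"
  shows "(\<Sum>l=1..p. 1 / real (l + 1)) / (2 * pi) \<le> (\<Sum>j<n. norm (1 / (perturbed_root n j * z - 1))) / real n"
proof -
  have n: "n > 0" using assms by simp
  have z: "norm z = 1" "0 \<le> Im z" using assms by (auto simp: kolmogorov_set_def)
  obtain x where x: "z = cis (2 * pi * x)" "0 \<le> x" "x \<le> 1 / 2"
  proof
    have "z \<noteq> 0" using z by auto
    have "0 \<le> Arg z" using z by (simp add: Arg_less_0)
    then show "z = cis (2 * pi * (Arg z / (2 * pi)))" "0 \<le> Arg z / (2 * pi)" "Arg z / (2 * pi) \<le> 1 / 2"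
      using z \<open>z \<noteq> 0\<close> Arg_le_pi[of z] cis_Arg[of z] by (auto simp: sgn_eq)
  qed
  \<comment> \<open>The last index whose unperturbed angle is at most that of \<open>1 / z\<close>.
    It equals \<open>n\<close> if \<open>x = 0\<close>, which is why the sum uses
    \<open>i - l\<close> with \<open>l\<close> from 1 on.\<close>
  define i where "i = nat \<lfloor>real n * (1 - x)\<rfloor>"
  have pn: "real p \<le> real n * (1 - x)" using x assms by (simp add: field_simps)
  have i: "real i \<le> real n * (1 - x)" "real n * (1 - x) < real i + 1"
    using x pn by (auto simp: i_def)
  have "p \<le> i" using pn by (simp add: i_def le_nat_floor)
  have "real n * (1 - x) \<le> real n" using x by (simp add: algebra_simps)
  then have "i \<le> n" using i by linarith
  have summand: "real n * (1 / real (l + 1) / (2 * pi)) \<le> norm (1 / (perturbed_root n (i - l) * z - 1))"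
    if "l \<in> {1..p}" for l
  proof -
    let ?j = "i - l"
    have l: "l \<le> i" "1 \<le> l" using that \<open>p \<le> i\<close> by auto
    have *: "perturbed_root n ?j * z - 1 = cis (2 * pi * ((real ?j + 1 / 4 ^ Suc ?j) / real n + x - 1)) - 1"
    proof -
      have "cis (2 * pi * ((real ?j + 1 / 4 ^ Suc ?j) / real n + x - 1)) =
        cis (2 * pi * ((real ?j + 1 / 4 ^ Suc ?j) / real n)) * cis (2 * pi * x) * cis (- (2 * pi))"
        by (simp add: cis_mult algebra_simps)
      moreover have "cis (- (2 * pi)) = 1" using cis_multiple_2pi[of "- 1"] by simp
      ultimately show ?thesis by (simp add: perturbed_root_def x)
    qed
    \<comment> \<open>The perturbation and the rounding in \<open>i\<close> both lie between 0 and 1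
      and enter with opposite signs, so together they change the distance \<open>l\<close> by at
      most 1.\<close>
    have "(1::real) / 4 ^ Suc ?j \<le> 1" by (simp add: field_simps del: power_Suc)
    moreover have "(0::real) \<le> 1 / 4 ^ Suc ?j" by simp
    moreover have "real ?j = real i - real l" "1 \<le> real l" using l by auto
    moreover have "real n * (1 - x) = real n - real n * x" by (simp add: algebra_simps)
    ultimately have "\<bar>real ?j + 1 / 4 ^ Suc ?j + real n * x - real n\<bar> \<le> real (l + 1)"
      using i unfolding abs_le_iff of_nat_add of_nat_1 by (intro conjI; linarith)
    then have "\<bar>real ?j + 1 / 4 ^ Suc ?j + real n * x - real n\<bar> / real n \<le> real (l + 1) / real n"
      by (rule divide_right_mono) simp
    moreover have "(real ?j + 1 / 4 ^ Suc ?j) / real n + x - 1 =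
        (real ?j + 1 / 4 ^ Suc ?j + real n * x - real n) / real n"
      using n by (simp only: add_divide_distrib diff_divide_distrib) simp
    ultimately have "\<bar>(real ?j + 1 / 4 ^ Suc ?j) / real n + x - 1\<bar> \<le> real (l + 1) / real n"
      by (simp only: abs_divide) simp
    then have "2 * pi * \<bar>(real ?j + 1 / 4 ^ Suc ?j) / real n + x - 1\<bar> \<le> 2 * pi * (real (l + 1) / real n)"
      by (rule mult_left_mono) simp
    then have "norm (perturbed_root n ?j * z - 1) \<le> 2 * pi * (real (l + 1) / real n)"
      unfolding * using norm_cis_diff_1_le[of "2 * pi * ((real ?j + 1 / 4 ^ Suc ?j) / real n + x - 1)"]
      by (simp only: abs_mult abs_numeral abs_of_pos[OF pi_gt_zero])
    moreover have "norm (perturbed_root n ?j * z - 1) > 0"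
      using perturbed_root_away_from_pole[OF n assms(3), of ?j] by (auto intro: ccontr)
    ultimately have "1 / (2 * pi * (real (l + 1) / real n)) \<le> 1 / norm (perturbed_root n ?j * z - 1)"
      by (intro divide_left_mono) (auto simp: n)
    then show ?thesis by (simp add: norm_divide field_simps)
  qed
  have "real n * ((\<Sum>l=1..p. 1 / real (l + 1)) / (2 * pi)) = (\<Sum>l=1..p. real n * (1 / real (l + 1) / (2 * pi)))"
    by (simp add: sum_divide_distrib sum_distrib_left)
  also have "\<dots> \<le> (\<Sum>l=1..p. norm (1 / (perturbed_root n (i - l) * z - 1)))"
    by (intro sum_mono summand)
  also have "\<dots> = (\<Sum>j\<in>(\<lambda>l. i - l) ` {1..p}. norm (1 / (perturbed_root n j * z - 1)))"
    using \<open>p \<le> i\<close> by (subst sum.reindex) (auto simp: inj_on_def)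
  also have "\<dots> \<le> (\<Sum>j<n. norm (1 / (perturbed_root n j * z - 1)))"
    using \<open>p \<le> i\<close> \<open>i \<le> n\<close> n by (intro sum_mono2) auto
  finally show ?thesis using n by (simp add: field_simps)
qed

text \<open>For each root the block is a geometric sum, so only its two ends remain. These are
  multiples of \<open>n\<close>, where the powers of the root are digit phases;
  \<open>b \<le> 4 ^ n\<close> keeps the block in the window where the kernel has coefficients
  1.\<close>

lemma sum_block_kolmogorov_poly:
  assumes "n > 0" "z \<in> kolmogorov_set n" "a \<le> b" "b \<le> 4 ^ n"
  defines "c \<equiv> \<lambda>j. 1 / (perturbed_root n j * z - 1)"
  shows "(\<Sum>l = n * 4 ^ n + n * a..<n * 4 ^ n + n * b. coeff (kolmogorov_poly n) l * z ^ l) =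
    z ^ (n * 4 ^ n) * (z ^ (n * b) * (\<Sum>j<n. digit_phase b j * c j)
      - z ^ (n * a) * (\<Sum>j<n. digit_phase a j * c j)) / of_nat n"
proof -
  let ?K = "n * 4 ^ n"
  let ?I = "{?K + n * a..<?K + n * b}"
  have "n * b \<le> ?K" using assms by simp
  then have bound: "l < 2 * ?K" if "l \<in> ?I" for l
    using that unfolding atLeastLessThan_iff by linarith
  have "(\<Sum>l\<in>?I. coeff (kolmogorov_poly n) l * z ^ l) =
      (\<Sum>l\<in>?I. (\<Sum>j<n. (perturbed_root n j * z) ^ l) / of_nat n)"
    using assms(1) by (intro sum.cong refl, subst coeff_kolmogorov_poly)
      (simp_all add: bound[simplified] sum_distrib_right power_mult_distrib)
  also have "\<dots> = (\<Sum>j<n. \<Sum>l\<in>?I. (perturbed_root n j * z) ^ l) / of_nat n"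
    by (subst sum.swap) (simp add: sum_divide_distrib)
  also have "(\<Sum>j<n. \<Sum>l\<in>?I. (perturbed_root n j * z) ^ l) =
      (\<Sum>j<n. z ^ ?K * (z ^ (n * b) * (digit_phase b j * c j) - z ^ (n * a) * (digit_phase a j * c j)))"
  proof (intro sum.cong refl)
    fix j assume j: "j \<in> {..<n}"
    let ?y = "perturbed_root n j * z"
    have y: "?y \<noteq> 1" using perturbed_root_away_from_pole[OF assms(1,2), of j] by auto
    have pw: "?y ^ (?K + n * m) = z ^ ?K * (z ^ (n * m) * digit_phase m j)" for m
      using perturbed_root_period[of j n] j perturbed_root_power[OF assms(1), of j m]
      by (simp add: power_add power_mult_distrib)
    have "(\<Sum>l\<in>?I. ?y ^ l) * (?y - 1) = (\<Sum>l\<in>?I. ?y ^ Suc l - ?y ^ l)"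
      unfolding sum_distrib_right by (intro sum.cong) (auto simp: algebra_simps)
    also have "\<dots> = ?y ^ (?K + n * b) - ?y ^ (?K + n * a)"
      using assms(3) by (intro sum_Suc_diff') simp
    finally have "(\<Sum>l\<in>?I. ?y ^ l) = (?y ^ (?K + n * b) - ?y ^ (?K + n * a)) * c j"
      using y by (simp add: c_def nonzero_eq_divide_eq)
    then show "(\<Sum>l\<in>?I. ?y ^ l) = z ^ ?K * (z ^ (n * b) * (digit_phase b j * c j) - z ^ (n * a) * (digit_phase a j * c j))"
      unfolding pw by (simp add: algebra_simps)
  qed
  also have "\<dots> = z ^ ?K * (z ^ (n * b) * (\<Sum>j<n. digit_phase b j * c j) - z ^ (n * a) * (\<Sum>j<n. digit_phase a j * c j))"
    by (simp only: sum_distrib_left[symmetric] sum_subtractf)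
  finally show ?thesis .
qed

text \<open>With aligned phases a boundary sum is at least \<open>n L / 2\<close>. With cancelling
  phases its square is at most the sum of the squared \<open>norm (?c j)\<close>, hence at most
  \<open>n^2 L\<close> because each \<open>norm (?c j)\<close> is at most \<open>n\<close>.\<close>

lemma ex_large_block:
  assumes "p > 0" "n = 2 * p" "z \<in> kolmogorov_set n"
  defines "L \<equiv> (\<Sum>j<n. norm (1 / (perturbed_root n j * z - 1))) / real n"
  shows "\<exists>a b. L / 2 - sqrt L \<le> norm (\<Sum>l=a..<b. coeff (kolmogorov_poly n) l * z ^ l)"
proof -
  let ?c = "\<lambda>j. 1 / (perturbed_root n j * z - 1)"
  have n: "n > 0" using assms by simp
  have z: "norm z = 1" using assms by (auto simp: kolmogorov_set_def)
  define B where "B = (\<lambda>m. \<Sum>j<n. digit_phase m j * ?c j)"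
  define D where "D = (\<lambda>a b. norm (z ^ (n * 4 ^ n) * (z ^ (n * b) * B b - z ^ (n * a) * B a) / of_nat n))"
  obtain k where k: "k < 4 ^ n" "(\<Sum>j<n. norm (?c j)) / 2 \<le> Re (B k)"
    using ex_aligned_phases[of n ?c] by (auto simp: B_def)
  obtain m where m: "m < 4 ^ n" "(norm (B m))\<^sup>2 \<le> (\<Sum>j<n. (norm (?c j))\<^sup>2)"
    using ex_cancelling_phases[of n ?c] by (auto simp: B_def)
  have cn: "norm (?c j) \<le> real n" for j
    using perturbed_root_away_from_pole[OF n assms(3), of j]
    by (cases "norm (perturbed_root n j * z - 1) = 0") (auto simp: norm_divide divide_le_eq)
  have "(norm (B m))\<^sup>2 \<le> (\<Sum>j<n. real n * norm (?c j))"
    using cn by (intro order.trans[OF m(2)] sum_mono) (simp add: power2_eq_square mult_right_mono)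
  also have "\<dots> = (real n)\<^sup>2 * L"
    using n by (simp add: L_def power2_eq_square flip: sum_distrib_left)
  finally have "norm (B m) \<le> sqrt ((real n)\<^sup>2 * L)"
    by (rule real_le_rsqrt)
  then have Bm: "norm (B m) \<le> real n * sqrt L"
    by (simp add: real_sqrt_mult)
  have Bk: "real n * (L / 2) \<le> norm (B k)"
    using k(2) complex_Re_le_cmod[of "B k"] n by (simp add: L_def)
  have D_eq: "D a b = norm (z ^ (n * b) * B b - z ^ (n * a) * B a) / real n" for a b
    using z by (simp add: D_def norm_mult norm_divide norm_power)
  \<comment> \<open>The aligning and the cancelling exponents come in an unknown order, while a
    block has its smaller end first.\<close>
  have sym: "D k m = D m k"
    by (simp only: D_eq norm_minus_commute)
  have "real n * L / 2 - real n * sqrt L \<le> norm (B k) - norm (B m)"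
    using Bm Bk by simp
  also have "\<dots> \<le> norm (z ^ (n * k) * B k - z ^ (n * m) * B m)"
    using norm_triangle_ineq2[of "z ^ (n * k) * B k" "z ^ (n * m) * B m"] z
    by (simp add: norm_mult norm_power)
  finally have "(real n * L / 2 - real n * sqrt L) / real n \<le> D m k"
    unfolding D_eq by (rule divide_right_mono) simp
  then have D: "L / 2 - sqrt L \<le> D m k"
    using n by (simp add: diff_divide_distrib)
  show ?thesis
  proof (cases "m \<le> k")
    case True
    have "D m k = norm (\<Sum>l = n * 4 ^ n + n * m..<n * 4 ^ n + n * k. coeff (kolmogorov_poly n) l * z ^ l)"
      using sum_block_kolmogorov_poly[OF n assms(3) True] k by (simp only: D_def B_def less_imp_le)
    then show ?thesis using D by metis
  next
    case False
    have "D k m = norm (\<Sum>l = n * 4 ^ n + n * k..<n * 4 ^ n + n * m. coeff (kolmogorov_poly n) l * z ^ l)"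
      using sum_block_kolmogorov_poly[OF n assms(3), of k m] m False by (simp only: D_def B_def less_imp_le linear not_le)
    then show ?thesis using D sym by metis
  qed
qed

text \<open>Once \<open>L\<close> is at least 16, \<open>sqrt L\<close> is at most
  \<open>L / 4\<close>, and the remaining \<open>L / 4\<close> is at least
  \<open>M + 4\<close>.\<close>

lemma half_minus_sqrt_mono:
  fixes L M :: real
  assumes "4 * (\<bar>M\<bar> + 4) \<le> L"
  shows "M < L / 2 - sqrt L"
proof -
  have L: "16 \<le> L" using order.trans[OF _ assms, of 16] by simp
  have M: "M + 4 \<le> L / 4" using assms by (simp add: abs_le_iff field_simps)
  have "sqrt L \<le> L / 4"
  proof (rule real_le_lsqrt)
    have "16 * L \<le> L * L" using L by (intro mult_right_mono) auto
    then show "L \<le> (L / 4)\<^sup>2" by (simp add: power2_eq_square)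
  qed (use L in auto)
  then show ?thesis using M by linarith
qed
lemma harm_Suc_eq: "harm (Suc p) = 1 + (\<Sum>l=1..p. 1 / real (l + 1))"
proof -
  have "(harm (Suc p) :: real) = 1 + (\<Sum>k = Suc 1..Suc p. inverse (real k))"
    unfolding harm_def by (subst sum.atLeast_Suc_atMost) simp_all
  also have "(\<Sum>k = Suc 1..Suc p. inverse (real k)) = (\<Sum>l=1..p. 1 / real (l + 1))"
    unfolding sum.shift_bounds_cl_Suc_ivl by (simp add: inverse_eq_divide)
  finally show ?thesis .
qed

theorem ex_kolmogorov_poly:
  fixes M :: real
  shows "\<exists>n>0. even n \<and> (\<forall>z\<in>kolmogorov_set n. \<exists>a b.
      M < norm (\<Sum>l=a..<b. coeff (kolmogorov_poly n) l * z ^ l))"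
proof -
  define T where "T = 4 * (\<bar>M\<bar> + 4)"
  \<comment> \<open>The summand 1 in the exponent pays for the first term of the harmonic number,
    which the sum in \<open>sum_pole_ge\<close> lacks; \<open>2 * pi\<close> is the constant
    there.\<close>
  obtain p :: nat where p: "exp (2 * pi * T + 1) \<le> real p"
    using real_arch_simple by blast
  have "p > 0" using p exp_gt_zero[of "2 * pi * T + 1"] by (intro gr0I) (auto simp: not_le)
  have "2 * pi * T + 1 \<le> ln (real (Suc p) + 1)"
  proof -
    have "2 * pi * T + 1 \<le> ln (real p)" using p \<open>p > 0\<close> by (simp add: ln_ge_iff)
    also have "\<dots> \<le> ln (real (Suc p) + 1)" using \<open>p > 0\<close> by simp
    finally show ?thesis .
  qed
  also have "\<dots> \<le> harm (Suc p)" by (rule ln_le_harm)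
  also note harm_Suc_eq
  finally have S: "T \<le> (\<Sum>l=1..p. 1 / real (l + 1)) / (2 * pi)"
    by (simp add: field_simps)
  show ?thesis
  proof (rule exI[of _ "2 * p"], intro conjI ballI)
    fix z assume z: "z \<in> kolmogorov_set (2 * p)"
    obtain a b where "(\<Sum>j<2*p. norm (1 / (perturbed_root (2*p) j * z - 1))) / real (2*p) / 2 -
        sqrt ((\<Sum>j<2*p. norm (1 / (perturbed_root (2*p) j * z - 1))) / real (2*p))
        \<le> norm (\<Sum>l=a..<b. coeff (kolmogorov_poly (2*p)) l * z ^ l)"
      using ex_large_block[OF \<open>p > 0\<close> refl z] by blast
    moreover have "T \<le> (\<Sum>j<2*p. norm (1 / (perturbed_root (2*p) j * z - 1))) / real (2*p)"
      using sum_pole_ge[OF \<open>p > 0\<close> refl z] S by linarith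
    ultimately show "\<exists>a b. M < norm (\<Sum>l=a..<b. coeff (kolmogorov_poly (2*p)) l * z ^ l)"
      using half_minus_sqrt_mono unfolding T_def by (meson less_le_trans)
  qed (use \<open>p > 0\<close> in auto)
qed

subsection \<open>Characters and Haar measure\<close>

lemma (in compact_abelian_group) restrict_in_characters:
  assumes "continuous_on (carrier G) \<gamma>" "\<And>x. x \<in> carrier G \<Longrightarrow> norm (\<gamma> x) = 1"
    and "\<And>x y. x \<in> carrier G \<Longrightarrow> y \<in> carrier G \<Longrightarrow> \<gamma> (x \<otimes> y) = \<gamma> x * \<gamma> y"
  shows "restrict \<gamma> (carrier G) \<in> characters G"
proof -
  have "continuous_on (carrier G) (restrict \<gamma> (carrier G)) \<longleftrightarrow> continuous_on (carrier G) \<gamma>"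
    by (intro continuous_on_cong) auto
  then show ?thesis
    using assms by (auto simp: characters_def hom_def circle_group_def)
qed

text \<open>The measure is a parameter instead of \<open>haar_measure G\<close>: that is a definite
  description, about which nothing is known before existence and uniqueness, and the uniqueness
  proof needs this theory for two measures at once.\<close>

locale haar_group = compact_abelian_group G
  for G :: "('a::t2_space, 'b) monoid_scheme" (structure) +
  fixes m :: "'a measure"
  assumes haar: "is_normalized_haar G m"
begin

lemma sets_haar: "sets m = sets (restrict_space borel (carrier G))"
  using haar by (simp add: is_normalized_haar_def)

lemma space_haar [simp]: "space m = carrier G"
  using sets_eq_imp_space_eq[OF sets_haar] by (simp add: space_restrict_space)

sublocale prob_space m
  using haar by (intro prob_spaceI) (simp add: is_normalized_haar_def)

lemma prob_carrier [simp]: "prob (carrier G) = 1"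
  using prob_space by simp

lemma continuous_imp_measurable:
  fixes f :: "'a \<Rightarrow> 'c::topological_space"
  assumes "continuous_on (carrier G) f"
  shows "f \<in> borel_measurable m"
  using borel_measurable_continuous_on_restrict[OF assms] measurable_cong_sets[OF sets_haar refl] by blast

lemma continuous_on_translation:
  assumes "a \<in> carrier G"
  shows "continuous_on (carrier G) (\<lambda>x. a \<otimes> x)"
proof -
  have "continuous_on (carrier G) (\<lambda>x. case (a, x) of (x, y) \<Rightarrow> x \<otimes> y)"
    by (rule continuous_on_compose2[OF continuous_mult])
       (use assms in \<open>auto intro!: continuous_on_Pair continuous_on_const continuous_on_id\<close>)
  then show ?thesis by simp
qed

lemma measurable_translation [measurable]:
  assumes "a \<in> carrier G"
  shows "(\<lambda>x. a \<otimes> x) \<in> measurable m m"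
proof -
  have "(\<lambda>x. a \<otimes> x) \<in> measurable m (restrict_space borel (carrier G))"
    using assms continuous_imp_measurable[OF continuous_on_translation[OF assms]]
    by (intro measurable_restrict_space2) auto
  then show ?thesis using measurable_cong_sets[OF refl sets_haar] by blast
qed

text \<open>Invariance is defined through images; the preimage under a translation is the image
  under the inverse one, which gives the form that integrals need.\<close>

lemma distr_translation:
  assumes a: "a \<in> carrier G"
  shows "distr m m (\<lambda>x. a \<otimes> x) = m"
proof (rule measure_eqI)
  fix A assume "A \<in> sets (distr m m (\<lambda>x. a \<otimes> x))"
  then have A: "A \<in> sets m" by simp
  then have sub: "A \<subseteq> carrier G" using sets.sets_into_space by fastforce
  have "(\<lambda>x. a \<otimes> x) -` A \<inter> space m = (\<lambda>x. inv a \<otimes> x) ` A"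
  proof (intro equalityI subsetI)
    fix x assume "x \<in> (\<lambda>x. a \<otimes> x) -` A \<inter> space m"
    then show "x \<in> (\<lambda>x. inv a \<otimes> x) ` A"
      using a by (intro image_eqI[of _ _ "a \<otimes> x"]) (auto simp flip: m_assoc)
  next
    fix x assume "x \<in> (\<lambda>x. inv a \<otimes> x) ` A"
    then show "x \<in> (\<lambda>x. a \<otimes> x) -` A \<inter> space m"
      using a sub by (auto simp: subset_iff simp flip: m_assoc)
  qed
  then have "emeasure (distr m m (\<lambda>x. a \<otimes> x)) A = emeasure m ((\<lambda>x. inv a \<otimes> x) ` A)"
    using A a by (simp add: emeasure_distr)
  also have "\<dots> = emeasure m A"
    using haar A a by (simp add: is_normalized_haar_def)
  finally show "emeasure (distr m m (\<lambda>x. a \<otimes> x)) A = emeasure m A" .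
qed simp

lemma integral_translation:
  fixes f :: "'a \<Rightarrow> complex"
  assumes "a \<in> carrier G" "f \<in> borel_measurable m"
  shows "(\<integral>x. f (a \<otimes> x) \<partial>m) = (\<integral>x. f x \<partial>m)"
  using integral_distr[OF measurable_translation[OF assms(1)] assms(2)] distr_translation[OF assms(1)]
  by simp

lemma character_measurable : "\<gamma> \<in> characters G \<Longrightarrow> \<gamma> \<in> borel_measurable m"
  by (rule continuous_imp_measurable) (simp add: characters_def)

lemma cnj_character_measurable: "\<gamma> \<in> characters G \<Longrightarrow> (\<lambda>x. cnj (\<gamma> x)) \<in> borel_measurable m"
  by (intro continuous_imp_measurable continuous_intros) (simp add: characters_def)

lemma norm_character: "\<gamma> \<in> characters G \<Longrightarrow> x \<in> carrier G \<Longrightarrow> norm (\<gamma> x) = 1"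
  by (force simp: characters_def hom_def circle_group_def)

lemma character_mult:
  "\<gamma> \<in> characters G \<Longrightarrow> x \<in> carrier G \<Longrightarrow> y \<in> carrier G \<Longrightarrow> \<gamma> (x \<otimes> y) = \<gamma> x * \<gamma> y"
  by (force simp: characters_def hom_def circle_group_def)

lemma integrable_bounded:
  fixes f :: "'a \<Rightarrow> complex"
  assumes "f \<in> borel_measurable m" "\<And>x. x \<in> carrier G \<Longrightarrow> norm (f x) \<le> B"
  shows "integrable m f"
  using assms by (intro integrable_const_bound[of _ B]) auto

text \<open>Translation by a point \<open>a\<close> where the characters differ multiplies the
  integral by \<open>\<gamma> a * cnj (\<eta> a)\<close>, which is not 1, so the integral
  vanishes.\<close>

lemma characters_orthonormal:
  assumes \<gamma>: "\<gamma> \<in> characters G" and \<eta>: "\<eta> \<in> characters G"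
  shows "(\<integral>x. \<gamma> x * cnj (\<eta> x) \<partial>m) = (if \<gamma> = \<eta> then 1 else 0)"
proof (cases "\<gamma> = \<eta>")
  case True
  have "(\<integral>x. \<gamma> x * cnj (\<gamma> x) \<partial>m) = (\<integral>x. 1 \<partial>m)"
    using norm_character[OF \<gamma>] by (intro Bochner_Integration.integral_cong) (auto simp: complex_norm_square[symmetric])
  then show ?thesis using True by simp
next
  case False
  obtain a where a: "a \<in> carrier G" "\<gamma> a \<noteq> \<eta> a"
    using False \<gamma> \<eta> extensionalityI[of \<gamma> "carrier G" \<eta>] by (auto simp: characters_def)
  note [measurable] = character_measurable[OF \<gamma>] cnj_character_measurable[OF \<eta>]
  let ?I = "\<integral>x. \<gamma> x * cnj (\<eta> x) \<partial>m"
  have "?I = (\<integral>x. \<gamma> (a \<otimes> x) * cnj (\<eta> (a \<otimes> x)) \<partial>m)"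
    by (rule integral_translation[OF a(1), symmetric]) measurable
  also have "\<dots> = (\<integral>x. (\<gamma> a * cnj (\<eta> a)) * (\<gamma> x * cnj (\<eta> x)) \<partial>m)"
    using a by (intro Bochner_Integration.integral_cong)
      (auto simp: character_mult[OF \<gamma>] character_mult[OF \<eta>])
  also have "\<dots> = (\<gamma> a * cnj (\<eta> a)) * ?I" by simp
  finally have "?I = 0 \<or> \<gamma> a * cnj (\<eta> a) = 1"
    by (metis mult_cancel_right1)
  moreover have "\<gamma> a * cnj (\<eta> a) \<noteq> 1"
  proof
    assume "\<gamma> a * cnj (\<eta> a) = 1"
    then have "\<gamma> a * (\<eta> a * cnj (\<eta> a)) = \<eta> a" by (simp add: algebra_simps)
    then show False
      using a norm_character[OF \<eta> a(1)] by (simp flip: complex_norm_square)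
  qed
  ultimately show ?thesis using False by simp
qed

lemma character_power:
  assumes "\<gamma> \<in> characters G"
  shows "(\<lambda>x\<in>carrier G. \<gamma> x ^ k) \<in> characters G"
proof (rule restrict_in_characters)
  show "continuous_on (carrier G) (\<lambda>x. \<gamma> x ^ k)"
    using assms by (intro continuous_intros) (auto simp: characters_def)
qed (use norm_character[OF assms] character_mult[OF assms] in \<open>auto simp: norm_power power_mult_distrib\<close>)

end

section \<open>Rotations of the Kolmogorov set and polynomials in a surjective character\<close>

lemma ex_quarter_turn_quadrant: "\<exists>d<4. Re (\<i> ^ d * w) \<le> 0 \<and> 0 \<le> Im (\<i> ^ d * w)"
proof -
  consider "Re w \<le> 0 \<and> 0 \<le> Im w" | "0 \<le> Im w \<and> 0 \<le> Re w" | "0 \<le> Re w \<and> Im w \<le> 0" | "Re w \<le> 0 \<and> Im w \<le> 0"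
    by linarith
  then show ?thesis
  proof cases
    case 1 then show ?thesis by (intro exI[of _ 0]) auto
  next
    case 2 then show ?thesis by (intro exI[of _ 1]) auto
  next
    case 3 then show ?thesis by (intro exI[of _ 2]) auto
  next
    case 4 then show ?thesis by (intro exI[of _ 3]) (auto simp: power3_eq_cube)
  qed
qed

text \<open>A rotation by \<open>pi d / (2 n)\<close> turns \<open>z ^ n\<close> by \<open>d\<close>
  quarter turns into the second quadrant. The sign then corrects \<open>Im z\<close>, and for even
  \<open>n\<close> it does not affect \<open>z ^ n\<close>.\<close>

lemma kolmogorov_set_rotations_cover:
  assumes "n > 0" "even n" "norm z = 1"
  shows "\<exists>d<4. \<exists>s<2. (- 1) ^ s * cis (pi / 2 * real d / real n) * z \<in> kolmogorov_set n"
proof -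
  obtain d :: nat where d: "d < 4" "Re (\<i> ^ d * z ^ n) \<le> 0" "0 \<le> Im (\<i> ^ d * z ^ n)"
    using ex_quarter_turn_quadrant by blast
  let ?y = "cis (pi / 2 * real d / real n) * z"
  have "cis (pi / 2 * real d / real n) ^ n = cis (pi / 2) ^ d"
    using assms by (simp only: Complex.DeMoivre) (simp add: mult.commute)
  then have y: "?y ^ n = \<i> ^ d * z ^ n"
    by (simp add: power_mult_distrib)
  have "(- 1) ^ (if 0 \<le> Im ?y then 0 else 1) * ?y \<in> kolmogorov_set n"
    using d assms unfolding y[symmetric]
    by (auto simp: kolmogorov_set_def norm_mult)
  then show ?thesis using d
    by (intro exI[of _ d] conjI exI[of _ "if 0 \<le> Im ?y then 0 else 1"]) (auto simp only: mult.assoc split: if_splits)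
qed

lemma closed_kolmogorov_set: "closed (kolmogorov_set n)"
proof -
  have "kolmogorov_set n = {z. norm z = 1} \<inter> {z. 0 \<le> Im z} \<inter> {z. Re (z ^ n) \<le> 0} \<inter> {z. 0 \<le> Im (z ^ n)}"
    by (auto simp: kolmogorov_set_def)
  also have "closed \<dots>"
    by (intro closed_Int closed_Collect_le closed_Collect_eq continuous_intros)
  finally show ?thesis .
qed

text \<open>Surjectivity serves two purposes: it makes the powers of \<open>h\<close> distinct
  characters, and it lifts rotations of the circle to translations of \<open>G\<close>.\<close>

locale surjective_character = haar_group G m
  for G :: "('a::t2_space, 'b) monoid_scheme" (structure) and m +
  fixes h :: "'a \<Rightarrow> complex"
  assumes h: "h \<in> characters G" and h_surj: "sphere 0 1 \<subseteq> h ` carrier G"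
begin

abbreviation h_pow :: "nat \<Rightarrow> 'a \<Rightarrow> complex" where
  "h_pow k \<equiv> \<lambda>x\<in>carrier G. h x ^ k"

lemma h_measurable [measurable]: "h \<in> borel_measurable m"
  using h by (rule character_measurable)

lemma norm_h [simp]: "x \<in> carrier G \<Longrightarrow> norm (h x) = 1"
  using norm_character[OF h] .

lemma h_pow_inj: "h_pow k = h_pow l \<longleftrightarrow> k = l"
proof -
  have False if "k < l" "h_pow k = h_pow l" for k l
  proof -
    \<comment> \<open>At this point the \<open>(l - k)\<close>-th power of \<open>h\<close> is -1,
      so the two powers differ.\<close>
    obtain x where x: "x \<in> carrier G" "h x = cis (pi / real (l - k))"
      using h_surj by (metis (no_types, lifting) imageE in_mono mem_sphere_0 norm_cis)
    have "h x ^ l = h x ^ k * h x ^ (l - k)" using that by (simp flip: power_add)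
    moreover have "h x ^ (l - k) = -1"
      using that unfolding x Complex.DeMoivre by simp
    moreover have "h x ^ k = h x ^ l" using that(2) x by (metis restrict_apply')
    ultimately show False using x by (simp add: x)
  qed
  then show ?thesis by (metis linorder_neqE_nat)
qed

lemma integral_h_power:
  assumes "\<gamma> \<in> characters G"
  shows "(\<integral>x. h x ^ k * cnj (\<gamma> x) \<partial>m) = (if \<gamma> = h_pow k then 1 else 0)"
proof -
  have "(\<integral>x. h x ^ k * cnj (\<gamma> x) \<partial>m) = (\<integral>x. h_pow k x * cnj (\<gamma> x) \<partial>m)"
    by (intro Bochner_Integration.integral_cong) auto
  then show ?thesis
    using characters_orthonormal[OF character_power[OF h, of k] assms] by auto
qed

lemma integrable_h_power_character:
  assumes "\<gamma> \<in> characters G"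
  shows "integrable m (\<lambda>x. h x ^ k * cnj (\<gamma> x))"
proof -
  note [measurable] = cnj_character_measurable[OF assms]
  show ?thesis
    using norm_character[OF assms] by (intro integrable_bounded[of _ 1]) (auto simp: norm_mult norm_power)
qed

lemma integral_poly_character:
  assumes "\<gamma> \<in> characters G"
  shows "(\<integral>x. poly P (h x) * cnj (\<gamma> x) \<partial>m) = (\<Sum>k\<le>degree P. coeff P k * (if \<gamma> = h_pow k then 1 else 0))"
proof -
  have "(\<integral>x. poly P (h x) * cnj (\<gamma> x) \<partial>m) = (\<integral>x. (\<Sum>k\<le>degree P. coeff P k * (h x ^ k * cnj (\<gamma> x))) \<partial>m)"
    by (simp add: poly_altdef sum_distrib_right mult.assoc)
  also have "\<dots> = (\<Sum>k\<le>degree P. coeff P k * (\<integral>x. h x ^ k * cnj (\<gamma> x) \<partial>m))"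
    using integrable_h_power_character[OF assms] by (subst Bochner_Integration.integral_sum) auto
  finally show ?thesis by (simp only: integral_h_power[OF assms])
qed

lemma integral_poly_h_pow: "(\<integral>x. poly P (h x) * cnj (h_pow k x) \<partial>m) = coeff P k"
proof -
  have "(\<Sum>i\<le>degree P. coeff P i * (if h_pow k = h_pow i then 1 else 0)) = (\<Sum>i\<le>degree P. if i = k then coeff P i else 0)"
    by (intro sum.cong) (auto simp: h_pow_inj)
  also have "\<dots> = coeff P k" by (auto simp: coeff_eq_0)
  finally show ?thesis
    by (simp only: integral_poly_character[OF character_power[OF h]])
qed

lemma integral_poly_other:
  assumes "\<gamma> \<in> characters G" "\<gamma> \<notin> range h_pow"
  shows "(\<integral>x. poly P (h x) * cnj (\<gamma> x) \<partial>m) = 0"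
  using assms by (auto simp: integral_poly_character intro!: sum.neutral)

lemma norm_poly_h_le:
  assumes "x \<in> carrier G" "norm w = 1"
  shows "norm (poly P (w * h x)) \<le> (\<Sum>k\<le>degree P. norm (coeff P k))"
  unfolding poly_altdef using assms
  by (intro sum_norm_le) (simp add: norm_mult norm_power power_mult_distrib)

lemma poly_measurable [measurable]: "(\<lambda>x. poly P (w * h x)) \<in> borel_measurable m"
  by (simp add: poly_altdef)

lemma integrable_poly: "norm w = 1 \<Longrightarrow> integrable m (\<lambda>x. poly P (w * h x))"
  by (intro integrable_bounded) (auto intro: norm_poly_h_le)

lemma integrable_norm_square_poly: "norm w = 1 \<Longrightarrow> integrable m (\<lambda>x. (norm (poly P (w * h x)))\<^sup>2)"
  by (intro integrable_const_bound[of _ "(\<Sum>k\<le>degree P. norm (coeff P k))\<^sup>2"])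
     (auto intro!: power_mono norm_poly_h_le)

text \<open>Parseval for \<open>N\<close> distinct characters; the rotation \<open>w\<close> only
  gives them unimodular coefficients.\<close>

lemma integral_norm_square_geom_poly:
  assumes "norm w = 1"
  shows "(\<integral>x. (norm (poly (geom_poly N) (w * h x)))\<^sup>2 \<partial>m) = real N"
proof -
  let ?F = "\<lambda>x. poly (geom_poly N) (w * h x)"
  have hk: "h_pow l \<in> characters G" for l using character_power[OF h] .
  have w: "w ^ l * cnj w ^ l = 1" for l
    using assms by (metis complex_norm_square of_real_1 one_power2 power_mult_distrib power_one)
  have "complex_of_real (\<integral>x. (norm (?F x))\<^sup>2 \<partial>m) = (\<integral>x. complex_of_real ((norm (?F x))\<^sup>2) \<partial>m)"
    by (rule integral_complex_of_real[symmetric])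
  also have "\<dots> = (\<integral>x. (\<Sum>l<N. \<Sum>k<N. (w ^ l * cnj w ^ k) * (h x ^ l * cnj (h_pow k x))) \<partial>m)"
    by (intro Bochner_Integration.integral_cong refl, subst complex_norm_square)
       (auto simp: poly_geom_poly sum_product power_mult_distrib intro!: sum.cong)
  also have "\<dots> = (\<Sum>l<N. \<Sum>k<N. (w ^ l * cnj w ^ k) * (\<integral>x. h x ^ l * cnj (h_pow k x) \<partial>m))"
    using integrable_h_power_character[OF hk]
    by (subst Bochner_Integration.integral_sum; (subst Bochner_Integration.integral_sum)?) auto
  also have "\<dots> = (\<Sum>l<N. \<Sum>k<N. if k = l then 1 else 0)"
    by (intro sum.cong refl, simp only: integral_h_power[OF hk] h_pow_inj) (auto simp: w)
  also have "\<dots> = complex_of_real (real N)" by simp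
  finally show ?thesis by (simp only: of_real_eq_iff)
qed

text \<open>The two factors have squared norms \<open>K\<close> and \<open>2 K\<close>, so AM-GM
  with the factor \<open>1 / K\<close> gives \<open>(K + 2 K) / (2 K)\<close>.\<close>

lemma integral_norm_vp_poly_le:
  assumes "norm w = 1" "K > 0"
  shows "(\<integral>x. norm (poly (vp_poly K) (w * h x)) \<partial>m) \<le> 3 / 2"
proof -
  let ?D = "\<lambda>N x. poly (geom_poly N) (w * h x)"
  have "norm (poly (vp_poly K) (w * h x)) \<le> ((norm (?D K x))\<^sup>2 + (norm (?D (2 * K) x))\<^sup>2) / (2 * real K)" for x
    using sum_squares_bound[of "norm (?D K x)" "norm (?D (2 * K) x)"] assms(2)
    by (simp add: vp_poly_def norm_mult norm_divide field_simps)
  then have "(\<integral>x. norm (poly (vp_poly K) (w * h x)) \<partial>m) \<le>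
    (\<integral>x. ((norm (?D K x))\<^sup>2 + (norm (?D (2 * K) x))\<^sup>2) / (2 * real K) \<partial>m)"
    using assms by (intro integral_mono integrable_norm integrable_poly integrable_divide_zero
      Bochner_Integration.integrable_add integrable_norm_square_poly) auto
  also have "\<dots> = ((\<integral>x. (norm (?D K x))\<^sup>2 \<partial>m) + (\<integral>x. (norm (?D (2 * K) x))\<^sup>2 \<partial>m)) / (2 * real K)"
    by (simp add: integrable_norm_square_poly assms(1))
  also have "\<dots> = 3 / 2"
    using assms by (simp add: integral_norm_square_geom_poly)
  finally show ?thesis .
qed

text \<open>An average of rotated kernels keeps their bound. Its independence of \<open>n\<close>,
  against block sums that grow with \<open>n\<close>, is the point of the construction.\<close>

lemma integral_norm_kolmogorov_poly_le:
  assumes "n > 0"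
  shows "(\<integral>x. norm (poly (kolmogorov_poly n) (h x)) \<partial>m) \<le> 3 / 2"
proof -
  let ?V = "\<lambda>j x. poly (vp_poly (n * 4 ^ n)) (perturbed_root n j * h x)"
  have "(\<integral>x. norm (poly (kolmogorov_poly n) (h x)) \<partial>m) \<le> (\<integral>x. (\<Sum>j<n. norm (?V j x)) / real n \<partial>m)"
    using integrable_poly[of 1 "kolmogorov_poly n"]
    by (intro integral_mono integrable_divide_zero Bochner_Integration.integrable_sum integrable_norm integrable_poly)
       (auto simp: poly_kolmogorov_poly norm_divide intro!: divide_right_mono norm_sum)
  also have "\<dots> = (\<Sum>j<n. \<integral>x. norm (?V j x) \<partial>m) / real n"
    by (simp add: integrable_poly)
  also have "\<dots> \<le> (\<Sum>j<n. 3 / 2) / real n"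
    using assms by (intro divide_right_mono sum_mono integral_norm_vp_poly_le) auto
  finally show ?thesis using assms by simp
qed

text \<open>Eight rotated copies of the set cover the circle.\<close>

lemma measure_kolmogorov_set_ge:
  assumes "n > 0" "even n"
  shows "{x \<in> carrier G. h x \<in> kolmogorov_set n} \<in> sets m"
    and "1 / 8 \<le> measure m {x \<in> carrier G. h x \<in> kolmogorov_set n}"
proof -
  let ?F = "{x \<in> carrier G. h x \<in> kolmogorov_set n}"
  have "h -` kolmogorov_set n \<inter> space m \<in> sets m"
    by (intro measurable_sets[OF h_measurable] borel_closed closed_kolmogorov_set)
  also have "h -` kolmogorov_set n \<inter> space m = ?F" by auto
  finally show F: "?F \<in> sets m" .
  \<comment> \<open>The rotations of the covering are lifted to translations of \<open>G\<close>,
    whose preimages of the set all have the same measure.\<close>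
  have "\<exists>a\<in>carrier G. h a = (- 1) ^ s * cis (pi / 2 * real d / real n)" for d s
  proof -
    have "(- 1) ^ s * cis (pi / 2 * real d / real n) \<in> sphere 0 1"
      by (simp add: norm_mult norm_power)
    then show ?thesis using h_surj by (metis (no_types, lifting) imageE in_mono)
  qed
  then have "\<forall>d s. \<exists>a. a \<in> carrier G \<and> h a = (- 1) ^ s * cis (pi / 2 * real d / real n)"
    by blast
  then obtain a where a: "\<And>d s. a d s \<in> carrier G" "\<And>d s. h (a d s) = (- 1) ^ s * cis (pi / 2 * real d / real n)"
    by metis
  let ?I = "{..<4::nat} \<times> {..<2::nat}"
  let ?T = "\<lambda>(d, s). (\<lambda>x. a d s \<otimes> x) -` ?F \<inter> space m"
  have "(\<lambda>x. a d s \<otimes> x) -` ?F \<inter> space m \<in> sets m" for d s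
    by (rule measurable_sets[OF measurable_translation[OF a(1)] F])
  moreover have "measure m ((\<lambda>x. a d s \<otimes> x) -` ?F \<inter> space m) = measure m ?F" for d s
    using measure_distr[OF measurable_translation[OF a(1)] F, of d s]
    unfolding distr_translation[OF a(1)] by (rule sym)
  ultimately have T: "?T i \<in> sets m" "measure m (?T i) = measure m ?F" for i
    by (simp_all only: split_beta)
  have "carrier G \<subseteq> (\<Union>i\<in>?I. ?T i)"
  proof
    fix x assume x: "x \<in> carrier G"
    obtain d s where "d < 4" "s < 2" "(- 1) ^ s * cis (pi / 2 * real d / real n) * h x \<in> kolmogorov_set n"
      using kolmogorov_set_rotations_cover[OF assms norm_h[OF x]] by blast
    then have "h (a d s \<otimes> x) \<in> kolmogorov_set n"
      using x a by (simp add: character_mult[OF h])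
    then show "x \<in> (\<Union>i\<in>?I. ?T i)"
      using x a \<open>d < 4\<close> \<open>s < 2\<close> by (intro UN_I[of "(d, s)"]) auto
  qed
  then have "1 \<le> measure m (\<Union>i\<in>?I. ?T i)"
    using T by (metis (no_types, lifting) finite_measure_mono prob_space space_haar sets.finite_UN finite_SigmaI finite_lessThan)
  also have "\<dots> \<le> (\<Sum>i\<in>?I. measure m (?T i))"
    using T by (intro finite_measure_subadditive_finite) auto
  also have "\<dots> = 8 * measure m ?F"
    by (simp only: T) (simp add: card_cartesian_product)
  finally show "1 / 8 \<le> measure m ?F" by simp
qed

end

subsection \<open>The gliding hump\<close>

text \<open>Multiplication by \<open>z ^ N i\<close> separates the supports and leaves the norms of
  block sums unchanged. The threshold \<open>4 ^ i\<close> is meant to survive the weight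
  \<open>1 / 2 ^ i\<close> that makes the series converge.\<close>

lemma ex_hump_sequence:
  obtains R :: "nat \<Rightarrow> complex poly" and n :: "nat \<Rightarrow> nat" and N :: "nat \<Rightarrow> nat"
  where "\<And>i. n i > 0" "\<And>i. even (n i)" "\<And>i. R i = monom 1 (N i) * kolmogorov_poly (n i)"
    "\<And>i. i \<le> N i"
    "\<And>i l. coeff (R i) l \<noteq> 0 \<Longrightarrow> N i \<le> l \<and> l < N (Suc i)" "incseq N"
    "\<And>i z. z \<in> kolmogorov_set (n i) \<Longrightarrow> \<exists>a b. 4 ^ i < norm (\<Sum>l=a..<b. coeff (R i) l * z ^ l)"
proof -
  have "\<forall>i::nat. \<exists>n>0. even n \<and> (\<forall>z\<in>kolmogorov_set n. \<exists>a b.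
      4 ^ i < norm (\<Sum>l=a..<b. coeff (kolmogorov_poly n) l * z ^ l))"
    using ex_kolmogorov_poly by blast
  then obtain n where n: "\<And>i. n i > 0" "\<And>i. even (n i)"
    "\<And>i z. z \<in> kolmogorov_set (n i) \<Longrightarrow> \<exists>a b. 4 ^ i < norm (\<Sum>l=a..<b. coeff (kolmogorov_poly (n i)) l * z ^ l)"
    by metis
  \<comment> \<open>One more than the degree is reserved for each hump, so the supports are disjoint
    and \<open>N i\<close> is at least \<open>i\<close>.\<close>
  define N where "N i = (\<Sum>j<i. degree (kolmogorov_poly (n j)) + 1)" for i
  define R where "R i = monom 1 (N i) * kolmogorov_poly (n i)" for i
  have Suc: "N (Suc i) = N i + degree (kolmogorov_poly (n i)) + 1" for i by (simp add: N_def)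
  show ?thesis
  proof (rule that[of n R N])
    show "i \<le> N i" for i by (induction i) (auto simp: Suc)
    show "incseq N" by (rule incseq_SucI) (simp add: Suc)
    show "N i \<le> l \<and> l < N (Suc i)" if "coeff (R i) l \<noteq> 0" for i l
    proof -
      have l: "N i \<le> l" "coeff (kolmogorov_poly (n i)) (l - N i) \<noteq> 0"
        using that by (auto simp: R_def coeff_monom_mult split: if_splits)
      then have "l - N i \<le> degree (kolmogorov_poly (n i))" by (intro le_degree)
      then show ?thesis using l by (simp add: Suc)
    qed
    show "\<exists>a b. 4 ^ i < norm (\<Sum>l=a..<b. coeff (R i) l * z ^ l)" if z: "z \<in> kolmogorov_set (n i)" for i z
    proof -
      obtain a b where ab: "4 ^ i < norm (\<Sum>l=a..<b. coeff (kolmogorov_poly (n i)) l * z ^ l)"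
        using n(3)[OF z] by blast
      have "norm z = 1" using z by (auto simp: kolmogorov_set_def)
      have "(\<Sum>l=a + N i..<b + N i. coeff (R i) l * z ^ l) = (\<Sum>l=a..<b. coeff (R i) (l + N i) * z ^ (l + N i))"
        by (rule sum.shift_bounds_nat_ivl)
      also have "\<dots> = z ^ N i * (\<Sum>l=a..<b. coeff (kolmogorov_poly (n i)) l * z ^ l)"
        unfolding sum_distrib_left by (intro sum.cong) (auto simp: R_def coeff_monom_mult power_add)
      finally have "norm (\<Sum>l=a + N i..<b + N i. coeff (R i) l * z ^ l) = norm (\<Sum>l=a..<b. coeff (kolmogorov_poly (n i)) l * z ^ l)"
        using \<open>norm z = 1\<close> by (simp add: norm_mult norm_power)
      with ab show ?thesis by (intro exI[of _ "a + N i"] exI[of _ "b + N i"]) simp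
    qed
  qed (use n R_def in auto)
qed

context surjective_character
begin

text \<open>The weights \<open>1 / 2 ^ i\<close> make the series of humps absolutely convergent in
  the mean, while a block of the \<open>i\<close>-th hump still exceeds \<open>2 ^ i\<close>. As the
  supports are disjoint, this is a block of \<open>f\<close> itself and violates the Cauchy
  criterion.\<close>

theorem ex_divergent_power_series:
  obtains f :: "'a \<Rightarrow> complex" and S :: "'a set"
  where "integrable m f"
    "\<And>\<gamma>. \<gamma> \<in> characters G \<Longrightarrow> \<gamma> \<notin> range h_pow \<Longrightarrow> (\<integral>x. f x * cnj (\<gamma> x) \<partial>m) = 0"
    "S \<in> sets m" "1 / 8 \<le> measure m S"
    "\<And>x. x \<in> S \<Longrightarrow> \<not> convergent (\<lambda>n. \<Sum>k<n. (\<integral>y. f y * cnj (h_pow k y) \<partial>m) * h x ^ k)"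
proof -
  obtain R :: "nat \<Rightarrow> complex poly" and n N :: "nat \<Rightarrow> nat"
    where n: "\<And>i. n i > 0" "\<And>i. even (n i)" and R: "\<And>i. R i = monom 1 (N i) * kolmogorov_poly (n i)"
      and N: "\<And>i. i \<le> N i"
      and supp: "\<And>i l. coeff (R i) l \<noteq> 0 \<Longrightarrow> N i \<le> l \<and> l < N (Suc i)" and N_mono: "incseq N"
      and large: "\<And>i z. z \<in> kolmogorov_set (n i) \<Longrightarrow> \<exists>a b. 4 ^ i < norm (\<Sum>l=a..<b. coeff (R i) l * z ^ l)"
    by (rule ex_hump_sequence) blast
  define g where "g i x = (1 / 2 ^ i) * poly (R i) (h x)" for i x
  define f where "f x = (\<Sum>i. g i x)" for x
  have g_int: "integrable m (g i)" for i
    using integrable_poly[of 1 "R i"] by (simp add: g_def[abs_def])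
  have norm_g: "(\<integral>x. norm (g i x) \<partial>m) \<le> 3 / 2 * (1 / 2) ^ i" for i
  proof -
    have "(\<integral>x. norm (g i x) \<partial>m) = (\<integral>x. (1 / 2) ^ i * norm (poly (kolmogorov_poly (n i)) (h x)) \<partial>m)"
      by (intro Bochner_Integration.integral_cong refl)
         (simp add: g_def R norm_mult norm_divide norm_power poly_monom power_divide)
    also have "\<dots> = (1 / 2) ^ i * (\<integral>x. norm (poly (kolmogorov_poly (n i)) (h x)) \<partial>m)" by simp
    also have "\<dots> \<le> (1 / 2) ^ i * (3 / 2)"
      by (intro mult_left_mono integral_norm_kolmogorov_poly_le n) simp
    finally show ?thesis by (simp add: mult.commute)
  qed
  have summable: "summable (\<lambda>i. \<integral>x. norm (g i x) \<partial>m)"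
    by (rule summable_comparison_test'[of "\<lambda>i. 3 / 2 * (1 / 2) ^ i" 0])
       (use norm_g in \<open>auto intro!: summable_mult summable_geometric\<close>)
  have AE_summable: "AE x in m. summable (\<lambda>i. norm (g i x))"
  proof -
    have g_meas [measurable]: "g i \<in> borel_measurable m" for i
      by (rule borel_measurable_integrable[OF g_int])
    have "(\<integral>\<^sup>+x. (\<Sum>i. ennreal (norm (g i x))) \<partial>m) = (\<Sum>i. \<integral>\<^sup>+x. ennreal (norm (g i x)) \<partial>m)"
      by (rule nn_integral_suminf) measurable
    also have "\<dots> = (\<Sum>i. ennreal (\<integral>x. norm (g i x) \<partial>m))"
      using g_int by (intro suminf_cong nn_integral_eq_integral integrable_norm) auto
    also have "\<dots> = ennreal (\<Sum>i. \<integral>x. norm (g i x) \<partial>m)"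
      by (rule suminf_ennreal2) (use summable in auto)
    finally have "(\<integral>\<^sup>+x. (\<Sum>i. ennreal (norm (g i x))) \<partial>m) \<noteq> \<infinity>" by simp
    then have "AE x in m. (\<Sum>i. ennreal (norm (g i x))) \<noteq> \<infinity>"
      by (intro nn_integral_noteq_infinite) measurable
    then show ?thesis
      by eventually_elim (rule summable_suminf_not_top, auto)
  qed
  have f_int: "integrable m f"
    unfolding f_def by (rule integrable_suminf[OF g_int AE_summable summable])
  have coeff_sums: "(\<integral>x. f x * cnj (\<gamma> x) \<partial>m) = (\<Sum>i. (1 / 2 ^ i) * (\<integral>x. poly (R i) (h x) * cnj (\<gamma> x) \<partial>m))"
    if \<gamma>: "\<gamma> \<in> characters G" for \<gamma>
  proof -
    have norm_g\<gamma>: "norm (g i x * cnj (\<gamma> x)) = norm (g i x)" if "x \<in> carrier G" for i x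
      using norm_character[OF \<gamma> that] by (simp add: norm_mult)
    have meas: "(\<lambda>x. g i x * cnj (\<gamma> x)) \<in> borel_measurable m" for i
      using g_int cnj_character_measurable[OF \<gamma>] by (intro borel_measurable_times) auto
    have int: "integrable m (\<lambda>x. g i x * cnj (\<gamma> x))" for i
      by (rule Bochner_Integration.integrable_bound[OF g_int meas]) (auto simp: norm_g\<gamma>)
    have "(\<integral>x. f x * cnj (\<gamma> x) \<partial>m) = (\<integral>x. (\<Sum>i. g i x * cnj (\<gamma> x)) \<partial>m)"
    proof (rule integral_cong_AE)
      show "(\<lambda>x. f x * cnj (\<gamma> x)) \<in> borel_measurable m"
        using f_int cnj_character_measurable[OF \<gamma>] by (intro borel_measurable_times) auto
      show "(\<lambda>x. \<Sum>i. g i x * cnj (\<gamma> x)) \<in> borel_measurable m"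
        by (intro borel_measurable_suminf meas)
      show "AE x in m. f x * cnj (\<gamma> x) = (\<Sum>i. g i x * cnj (\<gamma> x))"
        using AE_summable
        by eventually_elim (simp add: f_def suminf_mult2 summable_norm_cancel)
    qed
    also have "\<dots> = (\<Sum>i. \<integral>x. g i x * cnj (\<gamma> x) \<partial>m)"
    proof (rule integral_suminf[OF int])
      show "AE x in m. summable (\<lambda>i. norm (g i x * cnj (\<gamma> x)))"
        using AE_summable AE_space by eventually_elim (simp add: norm_g\<gamma>)
      have "(\<integral>x. norm (g i x * cnj (\<gamma> x)) \<partial>m) = (\<integral>x. norm (g i x) \<partial>m)" for i
        by (intro Bochner_Integration.integral_cong) (auto simp: norm_g\<gamma>)
      then show "summable (\<lambda>i. \<integral>x. norm (g i x * cnj (\<gamma> x)) \<partial>m)" using summable by simp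
    qed
    also have "\<dots> = (\<Sum>i. (1 / 2 ^ i) * (\<integral>x. poly (R i) (h x) * cnj (\<gamma> x) \<partial>m))"
      by (simp add: g_def mult.assoc)
    finally show ?thesis .
  qed
  define a where "a k = (\<integral>x. f x * cnj (h_pow k x) \<partial>m)" for k
  have a_eq: "a k = (1 / 2 ^ i) * coeff (R i) k" if "N i \<le> k" "k < N (Suc i)" for i k
  proof -
    have other: "coeff (R j) k = 0" if "j \<noteq> i" for j
    proof (rule ccontr)
      assume "coeff (R j) k \<noteq> 0"
      then have j: "N j \<le> k" "k < N (Suc j)" using supp by auto
      show False
      proof (cases "j < i")
        case True
        then show False using incseqD[OF N_mono, of "Suc j" i] j \<open>N i \<le> k\<close> by simp
      next
        case False
        then show False using incseqD[OF N_mono, of "Suc i" j] j \<open>k < N (Suc i)\<close> \<open>j \<noteq> i\<close> by simp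
      qed
    qed
    have "a k = (\<Sum>j. (1 / 2 ^ j) * coeff (R j) k)"
      unfolding a_def coeff_sums[OF character_power[OF h]] integral_poly_h_pow ..
    also have "\<dots> = (\<Sum>j\<in>{i}. (1 / 2 ^ j) * coeff (R j) k)"
      by (rule suminf_finite) (auto simp: other)
    finally show ?thesis by simp
  qed
  have block: "\<exists>p q. i \<le> p \<and> p \<le> q \<and> 1 \<le> norm (\<Sum>l=p..<q. a l * z ^ l)"
    if z: "z \<in> kolmogorov_set (n i)" for i z
  proof -
    obtain p q where pq: "4 ^ i < norm (\<Sum>l=p..<q. coeff (R i) l * z ^ l)"
      using large[OF z] by blast
    \<comment> \<open>The block is cut down to the support of the \<open>i\<close>-th hump, where
      \<open>a\<close> is a multiple of the coefficients of \<open>R i\<close>. It then begins at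
      \<open>N i\<close> or later, hence beyond \<open>i\<close>.\<close>
    let ?p = "max p (N i)" and ?q = "min q (N (Suc i))"
    have "(\<Sum>l=p..<q. coeff (R i) l * z ^ l) = (\<Sum>l=?p..<?q. coeff (R i) l * z ^ l)"
    proof (rule sum.mono_neutral_right)
      show "\<forall>l\<in>{p..<q} - {?p..<?q}. coeff (R i) l * z ^ l = 0"
      proof
        fix l assume "l \<in> {p..<q} - {?p..<?q}"
        then have "\<not> (N i \<le> l \<and> l < N (Suc i))" by auto
        then have "coeff (R i) l = 0" using supp by blast
        then show "coeff (R i) l * z ^ l = 0" by simp
      qed
    qed auto
    also have "\<dots> = (\<Sum>l=?p..<?q. 2 ^ i * (a l * z ^ l))"
      by (intro sum.cong) (auto simp: a_eq[of i])
    also have "\<dots> = 2 ^ i * (\<Sum>l=?p..<?q. a l * z ^ l)" by (simp only: sum_distrib_left)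
    finally have *: "4 ^ i < 2 ^ i * norm (\<Sum>l=?p..<?q. a l * z ^ l)"
      using pq by (simp add: norm_mult norm_power)
    moreover have "(4::real) ^ i = 2 ^ i * 2 ^ i" by (simp flip: power_mult_distrib)
    ultimately have "2 ^ i < norm (\<Sum>l=?p..<?q. a l * z ^ l)" by simp
    moreover have "(1::real) \<le> 2 ^ i" by simp
    ultimately have ge: "1 \<le> norm (\<Sum>l=?p..<?q. a l * z ^ l)" by linarith
    \<comment> \<open>Otherwise the interval would be empty and the sum 0.\<close>
    have "?p \<le> ?q"
    proof (rule ccontr)
      assume "\<not> ?p \<le> ?q"
      then have "{?p..<?q} = {}" by (intro atLeastLessThan_empty) linarith
      then show False using ge by (simp only:) simp
    qed
    then show ?thesis using N[of i] ge by (intro exI[of _ ?p] exI[of _ ?q]) auto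
  qed
  define F where "F i = {x \<in> carrier G. h x \<in> kolmogorov_set (n i)}" for i
  have F: "F i \<in> sets m" "1 / 8 \<le> measure m (F i)" for i
    using measure_kolmogorov_set_ge[OF n] by (auto simp: F_def)
  \<comment> \<open>The points in infinitely many \<open>F i\<close>. Continuity from above already
    gives a positive measure; no independence of the sets is involved.\<close>
  define S where "S = (\<Inter>i. \<Union>j\<in>{i..}. F j)"
  have S: "S \<in> sets m" unfolding S_def using F by auto
  have "decseq (\<lambda>i. \<Union>j\<in>{i..}. F j)"
    unfolding decseq_def by (intro allI impI UN_mono) auto
  then have "(\<lambda>i. measure m (\<Union>j\<in>{i..}. F j)) \<longlonglongrightarrow> measure m S"
    unfolding S_def using F(1) by (intro finite_Lim_measure_decseq) auto
  moreover have "1 / 8 \<le> measure m (\<Union>j\<in>{i..}. F j)" for i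
    using F by (intro order.trans[OF F(2)[of i]] finite_measure_mono) auto
  ultimately have S_measure: "1 / 8 \<le> measure m S"
    by (intro LIMSEQ_le_const) auto
  have divergent: "\<not> convergent (\<lambda>n. \<Sum>k<n. a k * h x ^ k)" if x: "x \<in> S" for x
  proof
    assume "convergent (\<lambda>n. \<Sum>k<n. a k * h x ^ k)"
    then have "Cauchy (\<lambda>n. \<Sum>k<n. a k * h x ^ k)" by (rule convergent_Cauchy)
    from CauchyD[OF this zero_less_one] obtain M
      where M: "\<forall>p\<ge>M. \<forall>q\<ge>M. norm ((\<Sum>k<p. a k * h x ^ k) - (\<Sum>k<q. a k * h x ^ k)) < 1"
      by blast
    obtain i where i: "M \<le> i" "x \<in> F i" using x by (auto simp: S_def)
    then obtain p q where pq: "i \<le> p" "p \<le> q" "1 \<le> norm (\<Sum>l=p..<q. a l * h x ^ l)"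
      using block[of "h x" i] unfolding F_def by blast
    have "(\<Sum>l=p..<q. a l * h x ^ l) = (\<Sum>k<q. a k * h x ^ k) - (\<Sum>k<p. a k * h x ^ k)"
      using pq(2) sum_diff_nat_ivl[of 0 p q "\<lambda>k. a k * h x ^ k"] by (simp add: atLeast0LessThan)
    moreover have "M \<le> p" "M \<le> q" using pq i by simp_all
    then have "norm ((\<Sum>k<q. a k * h x ^ k) - (\<Sum>k<p. a k * h x ^ k)) < 1" using M by blast
    ultimately show False using pq(3) by (simp only:)
  qed
  show ?thesis
  proof (rule that[OF f_int _ S S_measure])
    show "(\<integral>x. f x * cnj (\<gamma> x) \<partial>m) = 0" if "\<gamma> \<in> characters G" "\<gamma> \<notin> range h_pow" for \<gamma>
      by (simp add: coeff_sums[OF that(1)] integral_poly_other[OF that])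
  qed (use divergent in \<open>auto simp: a_def\<close>)
qed

end

subsection \<open>Dirichlet groups\<close>

lemma represents_frequency_unique:
  assumes "represents_frequency \<beta> x \<gamma>" "represents_frequency \<beta> y \<gamma>"
  shows "x = y"
proof (rule ccontr)
  assume "x \<noteq> y"
  \<comment> \<open>At this time the two exponentials differ by the factor
    \<open>exp (- (\<i> * pi))\<close>, which is -1.\<close>
  define t where "t = pi / (x - y)"
  have "exp (- (\<i> * of_real x * of_real t)) = exp (- (\<i> * of_real y * of_real t))"
    using assms by (metis represents_frequency_def)
  then have "exp (- (\<i> * of_real x * of_real t) - - (\<i> * of_real y * of_real t)) = 1"
    by (simp only: exp_diff) simp
  also have "- (\<i> * of_real x * of_real t) - - (\<i> * of_real y * of_real t) = - (\<i> * of_real ((x - y) * t))"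
    by (simp add: algebra_simps)
  also have "(x - y) * t = pi" using \<open>x \<noteq> y\<close> by (simp add: t_def)
  finally show False by (simp add: exp_minus mult.commute)
qed

lemma represents_frequency_inj:
  assumes "represents_frequency \<beta> x \<gamma>" "represents_frequency \<beta> x \<eta>"
  shows "\<gamma> (\<beta> t) = \<eta> (\<beta> t)"
  using assms by (simp add: represents_frequency_def)

context dirichlet_group
begin

lemma closure_range_\<beta>: "closure (range \<beta>) = carrier G"
  using \<beta>_dense \<beta>_closed compact_imp_closed[OF compact_carrier]
  by (intro equalityI closure_minimal) auto

lemma character_unique:
  assumes "\<gamma> \<in> characters G" "\<eta> \<in> characters G"
    and "represents_frequency \<beta> x \<gamma>" "represents_frequency \<beta> x \<eta>"
  shows "\<gamma> = \<eta>"
proof (rule extensionalityI[of _ "carrier G"])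
  show "\<gamma> \<in> extensional (carrier G)" "\<eta> \<in> extensional (carrier G)"
    using assms by (auto simp: characters_def)
  fix y assume y: "y \<in> carrier G"
  have "continuous_on (closure (range \<beta>)) (\<lambda>x. \<gamma> x - \<eta> x)"
    unfolding closure_range_\<beta> using assms by (intro continuous_intros) (auto simp: characters_def)
  then have "\<gamma> y - \<eta> y = 0"
    by (rule continuous_constant_on_closure)
       (use y represents_frequency_inj[OF assms(3,4)] closure_range_\<beta> in auto)
  then show "\<gamma> y = \<eta> y" by simp
qed

lemma freq_character_eq:
  assumes "\<gamma> \<in> characters G" "represents_frequency \<beta> x \<gamma>"
  shows "freq_character G \<beta> x = \<gamma>"
  unfolding freq_character_def using assms character_unique by (intro the_equality) blast+

end

lemma (in lambda_dirichlet_group) freq_character: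
  "freq_character G \<beta> (lam n) \<in> characters G"
  "represents_frequency \<beta> (lam n) (freq_character G \<beta> (lam n))"
  using character_exists[of n] freq_character_eq by auto

section \<open>From divergent power series to Riesz means\<close>

text \<open>A sum over an infinite set would be 0 by convention; finiteness makes
  \<open>riesz_mean\<close> the intended sum.\<close>

lemma frequency_finite_below:
  assumes "frequency lam"
  shows "finite {n. exp (lam n) < x}"
proof -
  \<comment> \<open>The maximum with 1 covers arguments \<open>x\<close> that are not positive,
    where \<open>ln x\<close> says nothing.\<close>
  obtain N where N: "ln (max x 1) < lam N"
  proof -
    have "\<not> (\<forall>y\<in>range lam. y \<le> ln (max x 1))"
      using assms unfolding frequency_def bdd_above_def by blast
    then show ?thesis using that by (auto simp: not_le)
  qed
  have "{n. exp (lam n) < x} \<subseteq> {..N}"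
  proof
    fix n assume "n \<in> {n. exp (lam n) < x}"
    then have "exp (lam n) < max x 1" by simp
    then have "lam n < ln (max x 1)" by (subst exp_less_cancel_iff[symmetric]) simp
    then have "lam n < lam N" using N by simp
    then show "n \<in> {..N}" using assms by (simp add: frequency_def strict_mono_less)
  qed
  then show ?thesis by (rule finite_subset) simp
qed

text \<open>Each partial sum is a fixed linear combination of two consecutive Riesz means:
  \<open>(q - 1) S (K + 1) = q R (K + 1) - R K\<close>.\<close>

lemma convergent_partial_sums_if_lacunary_riesz:
  fixes b :: "nat \<Rightarrow> complex"
  assumes "q > 1"
    and "((\<lambda>K. \<Sum>k<K. b k * of_real (1 - q ^ k / q ^ K)) \<longlongrightarrow> l) sequentially"
  shows "convergent (\<lambda>n. \<Sum>k<n. b k)"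
proof -
  define r where "r K = (\<Sum>k<K. b k * of_real (1 - q ^ k / q ^ K))" for K
  have q: "q \<noteq> 0" "complex_of_real q - 1 \<noteq> 0" using assms(1) by (auto simp: complex_eq_iff)
  have scaled: "of_real (q ^ K) * r K = (\<Sum>k<K. b k * of_real (q ^ K - q ^ k))" for K
    unfolding r_def sum_distrib_left
    by (intro sum.cong refl) (use q in \<open>simp add: right_diff_distrib\<close>)
  have "of_real (q ^ Suc K) * r (Suc K) - of_real (q ^ K) * r K = of_real (q ^ Suc K - q ^ K) * (\<Sum>k<Suc K. b k)" for K
  proof -
    \<comment> \<open>The added term \<open>k = K\<close> is 0; it gives both Riesz means the same
      range of summation.\<close>
    have "of_real (q ^ K) * r K = (\<Sum>k<Suc K. b k * of_real (q ^ K - q ^ k))"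
      unfolding scaled by simp
    then have "of_real (q ^ Suc K) * r (Suc K) - of_real (q ^ K) * r K =
        (\<Sum>k<Suc K. b k * of_real (q ^ Suc K - q ^ k) - b k * of_real (q ^ K - q ^ k))"
      by (simp only: scaled sum_subtractf)
    also have "\<dots> = (\<Sum>k<Suc K. of_real (q ^ Suc K - q ^ K) * b k)"
      by (intro sum.cong) (auto simp: algebra_simps)
    finally show ?thesis by (simp only: sum_distrib_left)
  qed
  then have "of_real (q ^ K) * (of_real q * r (Suc K) - r K) = of_real (q ^ K) * ((of_real q - 1) * (\<Sum>k<Suc K. b k))" for K
    by (simp add: algebra_simps)
  then have "of_real q * r (Suc K) - r K = (of_real q - 1) * (\<Sum>k<Suc K. b k)" for K
    using q(1) by (simp only: mult_cancel_left) simp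
  then have S: "(\<Sum>k<Suc K. b k) = (of_real q * r (Suc K) - r K) / (of_real q - 1)" for K
    using q(2) by (simp only: nonzero_mult_div_cancel_left not_False_eq_True)
  have "r \<longlonglongrightarrow> l" using assms(2) by (simp add: r_def[abs_def])
  then have "(\<lambda>K. (of_real q * r (Suc K) - r K) / (of_real q - 1)) \<longlonglongrightarrow> (of_real q * l - l) / (of_real q - 1)"
    using q by (intro tendsto_intros LIMSEQ_Suc) auto
  then have "(\<lambda>K. \<Sum>k<Suc K. b k) \<longlonglongrightarrow> (of_real q * l - l) / (of_real q - 1)"
    by (simp only: S)
  from LIMSEQ_imp_Suc[OF this] show ?thesis by (rule convergentI)
qed

text \<open>The function has its spectrum in the powers of \<open>h\<close>, so frequencies outside
  the progression contribute nothing to its Riesz means. At \<open>exp c ^ K\<close> exactly the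
  first \<open>K\<close> powers remain, with the weights of
  \<open>convergent_partial_sums_if_lacunary_riesz\<close>.\<close>

theorem ex_not_riesz_summable:
  fixes G :: "('a::t2_space, 'b) monoid_scheme"
  assumes "lambda_dirichlet_group lam G \<beta>" "frequency lam"
    and "is_normalized_haar G (haar_measure G)"
    and c: "c > 0" and progression: "\<And>k::nat. \<exists>n. lam n = real k * c"
  shows "\<exists>f\<in>hardy_H1 lam G \<beta>. \<not> (AE \<omega> in haar_measure G. riesz_summable_at lam G \<beta> f \<omega>)"
proof -
  interpret lambda_dirichlet_group lam G \<beta> by fact
  let ?m = "haar_measure G"
  interpret haar_group G ?m by unfold_locales fact
  obtain idx where idx: "\<And>k. lam (idx k) = real k * c" using progression by metis
  define h where "h = freq_character G \<beta> c"
  have hc: "h \<in> characters G" "represents_frequency \<beta> c h"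
    using freq_character[of "idx 1"] by (simp_all add: h_def idx)
  interpret surjective_character G ?m h
  proof
    show "sphere 0 1 \<subseteq> h ` carrier G"
    proof
      fix z :: complex assume "z \<in> sphere 0 1"
      then have z: "norm z = 1" by simp
      then have "z \<noteq> 0" by auto
      \<comment> \<open>As \<open>c\<close> is not 0, the values of \<open>h\<close> along
        \<open>\<beta>\<close> already run through the whole circle.\<close>
      have "h (\<beta> (- Arg z / c)) = exp (\<i> * of_real (Arg z))"
        using hc(2) c by (simp add: represents_frequency_def)
      also have "\<dots> = z" using Arg_eq[OF \<open>z \<noteq> 0\<close>] z by simp
      finally show "z \<in> h ` carrier G" using \<beta>_closed by (metis imageI)
    qed
  qed (rule hc(1))
  have h_pow: "freq_character G \<beta> (lam (idx k)) = h_pow k" for k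
  proof (rule freq_character_eq[OF character_power[OF hc(1)]])
    show "represents_frequency \<beta> (lam (idx k)) (h_pow k)"
      using hc(2) \<beta>_closed by (simp add: represents_frequency_def idx flip: exp_of_nat_mult) (simp add: mult_ac)
  qed
  have not_h_pow: "freq_character G \<beta> (lam n) \<notin> range h_pow" if "n \<notin> range idx" for n
  proof
    assume "freq_character G \<beta> (lam n) \<in> range h_pow"
    then obtain k where "freq_character G \<beta> (lam n) = freq_character G \<beta> (lam (idx k))"
      unfolding h_pow by blast
    then have "lam n = lam (idx k)"
      using freq_character(2) represents_frequency_unique by metis
    then have "n = idx k" using assms(2) by (simp add: frequency_def strict_mono_eq)
    then show False using that by auto
  qed
  obtain f S where f: "integrable ?m f"
    "\<And>\<gamma>. \<gamma> \<in> characters G \<Longrightarrow> \<gamma> \<notin> range h_pow \<Longrightarrow> (\<integral>x. f x * cnj (\<gamma> x) \<partial>?m) = 0"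
    and S: "S \<in> sets ?m" "1 / 8 \<le> measure ?m S"
    and divergent: "\<And>x. x \<in> S \<Longrightarrow> \<not> convergent (\<lambda>n. \<Sum>k<n. (\<integral>y. f y * cnj (h_pow k y) \<partial>?m) * h x ^ k)"
    using ex_divergent_power_series by blast
  define a where "a k = fourier_coeff G f (h_pow k)" for k
  have "f \<in> hardy_H1 lam G \<beta>"
    unfolding hardy_H1_def fourier_coeff_def
  proof (intro CollectI conjI ballI impI)
    fix \<gamma> assume "\<gamma> \<in> characters G" "(\<integral>x. f x * cnj (\<gamma> x) \<partial>?m) \<noteq> 0"
    then obtain k where "\<gamma> = h_pow k" using f(2) by blast
    then show "\<exists>n. \<gamma> = freq_character G \<beta> (lam n)" using h_pow[of k] by metis
  qed (rule f(1))
  moreover have riesz: "riesz_mean lam G \<beta> f (exp c ^ K) x = (\<Sum>k<K. a k * h x ^ k * of_real (1 - exp c ^ k / exp c ^ K))"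
    if x: "x \<in> carrier G" for x K
  proof -
    let ?t = "\<lambda>n. fourier_coeff G f (freq_character G \<beta> (lam n)) * of_real (1 - exp (lam n) / exp c ^ K) *
        freq_character G \<beta> (lam n) x"
    have "inj idx" using idx c by (intro injI) (metis mult_right_cancel of_nat_eq_iff less_irrefl)
    have below: "exp (lam (idx k)) = exp c ^ k" for k by (simp add: idx exp_of_nat_mult)
    have "riesz_mean lam G \<beta> f (exp c ^ K) x = (\<Sum>n\<in>idx ` {..<K}. ?t n)"
      unfolding riesz_mean_def
    proof (rule sum.mono_neutral_right[OF frequency_finite_below[OF assms(2)]])
      show "idx ` {..<K} \<subseteq> {n. exp (lam n) < exp c ^ K}"
        using c by (auto simp: below power_strict_increasing)
      show "\<forall>n\<in>{n. exp (lam n) < exp c ^ K} - idx ` {..<K}. ?t n = 0"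
      proof
        fix n assume n: "n \<in> {n. exp (lam n) < exp c ^ K} - idx ` {..<K}"
        have "n \<notin> range idx"
        proof
          assume "n \<in> range idx"
          then obtain k where k: "n = idx k" by blast
          then have "k < K" using n c by (simp add: below power_strict_increasing_iff)
          then show False using n k by simp
        qed
        then show "?t n = 0"
          using f(2)[OF freq_character(1) not_h_pow] by (simp add: fourier_coeff_def)
      qed
    qed
    also have "\<dots> = (\<Sum>k<K. ?t (idx k))"
      using \<open>inj idx\<close> by (subst sum.reindex) (auto simp: inj_on_def)
    also have "\<dots> = (\<Sum>k<K. a k * h x ^ k * of_real (1 - exp c ^ k / exp c ^ K))"
      by (intro sum.cong refl) (simp only: h_pow below a_def restrict_apply' x mult_ac)
    finally show ?thesis .
  qed
  have not_summable: "\<not> riesz_summable_at lam G \<beta> f x" if x: "x \<in> S" for x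
  proof
    assume "riesz_summable_at lam G \<beta> f x"
    then obtain l where "((\<lambda>y. riesz_mean lam G \<beta> f y x) \<longlongrightarrow> l) at_top"
      by (auto simp: riesz_summable_at_def)
    moreover have "filterlim (\<lambda>K. exp c ^ K) at_top sequentially"
      using filterlim_compose[OF exp_at_top filterlim_tendsto_pos_mult_at_top[OF tendsto_const c filterlim_real_sequentially]]
      by (simp only: exp_of_nat2_mult)
    ultimately have "((\<lambda>K. riesz_mean lam G \<beta> f (exp c ^ K) x) \<longlongrightarrow> l) sequentially"
      by (rule filterlim_compose)
    moreover have "x \<in> carrier G" using x sets.sets_into_space[OF S(1)] by auto
    ultimately have "((\<lambda>K. \<Sum>k<K. a k * h x ^ k * of_real (1 - exp c ^ k / exp c ^ K)) \<longlongrightarrow> l) sequentially"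
      by (simp only: riesz)
    then have "convergent (\<lambda>n. \<Sum>k<n. a k * h x ^ k)"
      by (rule convergent_partial_sums_if_lacunary_riesz[rotated]) (use c in simp)
    then show False using divergent[OF x] by (simp add: a_def fourier_coeff_def)
  qed
  have "\<not> (AE \<omega> in ?m. riesz_summable_at lam G \<beta> f \<omega>)"
  proof
    assume "AE \<omega> in ?m. riesz_summable_at lam G \<beta> f \<omega>"
    then have "AE \<omega> in ?m. \<omega> \<notin> S" by eventually_elim (use not_summable in blast)
    then have "measure ?m S = 0" using prob_eq_0[OF S(1)] by blast
    then show False using S(2) by simp
  qed
  ultimately show ?thesis by blast
qed

subsection \<open>Existence and uniqueness of Haar measure\<close>

text \<open>Integrating \<open>indicator A (x \<otimes> y)\<close> over both variables gives
  \<open>emeasure m A\<close> or \<open>emeasure m' A\<close> according to the order of integration.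
  Commutativity turns the right translation into a left one; second countability makes the
  multiplication measurable for the product of the two sigma-algebras.\<close>

lemma haar_unique:
  fixes G :: "('a::{t2_space, second_countable_topology}, 'b) monoid_scheme" (structure)
  assumes "compact_abelian_group G" "is_normalized_haar G m" "is_normalized_haar G m'"
  shows "m = m'"
proof -
  interpret compact_abelian_group G by fact
  interpret m: haar_group G m by unfold_locales fact
  interpret m': haar_group G m' by unfold_locales fact
  interpret pair_sigma_finite m m' by unfold_locales
  note sets_eq = m.sets_haar m'.sets_haar
  have "fst \<in> borel_measurable (m \<Otimes>\<^sub>M m')" "snd \<in> borel_measurable (m \<Otimes>\<^sub>M m')"
    using measurable_compose[OF measurable_fst m.continuous_imp_measurable[OF continuous_on_id]]
      measurable_compose[OF measurable_snd m'.continuous_imp_measurable[OF continuous_on_id]]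
    by auto
  then have "(\<lambda>p. (fst p, snd p)) \<in> borel_measurable (m \<Otimes>\<^sub>M m')"
    by (rule borel_measurable_Pair)
  then have "(\<lambda>p. p) \<in> measurable (m \<Otimes>\<^sub>M m') (restrict_space borel (carrier G \<times> carrier G))"
    by (intro measurable_restrict_space2) (auto simp: space_pair_measure)
  then have "(\<lambda>p. case p of (x, y) \<Rightarrow> x \<otimes> y) \<in> borel_measurable (m \<Otimes>\<^sub>M m')"
    by (rule measurable_compose[OF _ borel_measurable_continuous_on_restrict[OF continuous_mult]])
  then have "(\<lambda>p. case p of (x, y) \<Rightarrow> x \<otimes> y) \<in> measurable (m \<Otimes>\<^sub>M m') (restrict_space borel (carrier G))"
    by (intro measurable_restrict_space2) (auto simp: space_pair_measure)
  then have mult: "(\<lambda>p. case p of (x, y) \<Rightarrow> x \<otimes> y) \<in> measurable (m \<Otimes>\<^sub>M m') m"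
    using measurable_cong_sets[OF refl m.sets_haar] by blast
  show ?thesis
  proof (rule measure_eqI)
    show "sets m = sets m'" by (simp add: sets_eq)
    fix A assume A: "A \<in> sets m"
    then have A': "A \<in> sets m'" by (simp add: sets_eq)
    have "(\<lambda>p. indicator A (case p of (x, y) \<Rightarrow> x \<otimes> y) :: ennreal) \<in> borel_measurable (m \<Otimes>\<^sub>M m')"
      by (rule measurable_compose[OF mult]) (use A in simp)
    then have meas: "(\<lambda>(x, y). indicator A (x \<otimes> y) :: ennreal) \<in> borel_measurable (m \<Otimes>\<^sub>M m')"
      by (simp add: split_beta')
    have left: "(\<integral>\<^sup>+x. indicator A (x \<otimes> y) \<partial>m) = emeasure m A" if y: "y \<in> carrier G" for y
    proof -
      have "(\<integral>\<^sup>+x. indicator A (x \<otimes> y) \<partial>m) = (\<integral>\<^sup>+x. indicator A (y \<otimes> x) \<partial>m)"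
        using y by (intro nn_integral_cong) (simp add: m_comm)
      also have "\<dots> = (\<integral>\<^sup>+x. indicator A x \<partial>distr m m (\<lambda>x. y \<otimes> x))"
        using A y by (subst nn_integral_distr) auto
      finally show ?thesis using A by (simp add: m.distr_translation[OF y])
    qed
    have right: "(\<integral>\<^sup>+y. indicator A (x \<otimes> y) \<partial>m') = emeasure m' A" if x: "x \<in> carrier G" for x
    proof -
      have "(\<integral>\<^sup>+y. indicator A (x \<otimes> y) \<partial>m') = (\<integral>\<^sup>+y. indicator A y \<partial>distr m' m' (\<lambda>y. x \<otimes> y))"
        using A' x by (subst nn_integral_distr) auto
      then show ?thesis using A' by (simp add: m'.distr_translation[OF x])
    qed
    have "emeasure m A = (\<integral>\<^sup>+y. (\<integral>\<^sup>+x. indicator A (x \<otimes> y) \<partial>m) \<partial>m')"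
      using left by (subst nn_integral_cong[of m' _ "\<lambda>_. emeasure m A"]) (auto simp: m'.emeasure_space_1[simplified])
    also have "\<dots> = (\<integral>\<^sup>+x. (\<integral>\<^sup>+y. indicator A (x \<otimes> y) \<partial>m') \<partial>m)"
      by (rule Fubini'[OF meas])
    also have "\<dots> = emeasure m' A"
      using right by (subst nn_integral_cong[of m _ "\<lambda>_. emeasure m' A"]) (auto simp: m.emeasure_space_1[simplified])
    finally show "emeasure m A = emeasure m' A" .
  qed
qed

lemma is_normalized_haar_haar_measure:
  fixes G :: "('a::{t2_space, second_countable_topology}, 'b) monoid_scheme"
  assumes "compact_abelian_group G" "is_normalized_haar G m"
  shows "is_normalized_haar G (haar_measure G)"
  unfolding haar_measure_def
  by (rule theI[of _ m]) (use assms haar_unique in blast)+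

text \<open>The concrete measures are easier to build on the whole type, with the carrier of full
  measure. Inner regularity then comes for free on a Polish space.\<close>

lemma is_normalized_haar_restrict_space:
  fixes G :: "('a::polish_space, 'b) monoid_scheme" (structure)
  assumes "compact_abelian_group G" and M: "sets M = sets borel" "prob_space M" "emeasure M (carrier G) = 1"
    and translation: "\<And>a. a \<in> carrier G \<Longrightarrow> (\<lambda>x. a \<otimes> x) \<in> measurable M M"
      "\<And>a. a \<in> carrier G \<Longrightarrow> distr M M (\<lambda>x. a \<otimes> x) = M"
  shows "is_normalized_haar G (restrict_space M (carrier G))"
proof -
  interpret compact_abelian_group G by fact
  interpret prob_space M by fact
  let ?m = "restrict_space M (carrier G)"
  have space: "space M = UNIV" using sets_eq_imp_space_eq[OF M(1)] by simp
  have C: "carrier G \<in> sets M"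
    using borel_closed[OF compact_imp_closed[OF compact_carrier]] M(1) by simp
  have sets_iff: "A \<in> sets ?m \<longleftrightarrow> A \<subseteq> carrier G \<and> A \<in> sets M" for A
    by (rule sets_restrict_space_iff) (use C space in simp)
  have em: "emeasure ?m A = emeasure M A" if "A \<subseteq> carrier G" for A
    by (rule emeasure_restrict_space) (use C space that in simp_all)
  have full: "AE x in M. x \<in> carrier G"
    using AE_iff_emeasure_eq_1[of "\<lambda>x. x \<in> carrier G"] M(3) C by (simp add: space)
  have trans: "emeasure ?m ((\<lambda>x. a \<otimes> x) ` A) = emeasure ?m A" if a: "a \<in> carrier G" and A: "A \<in> sets ?m" for a A
  proof -
    have sub: "A \<subseteq> carrier G" "A \<in> sets M" using A sets_iff by auto
    have ia: "inv a \<in> carrier G" using a by simp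
    \<comment> \<open>The intersection is needed because nothing is known about products with points
      outside the carrier; as the carrier has full measure, it does not change the value.\<close>
    have image: "(\<lambda>x. a \<otimes> x) ` A = ((\<lambda>x. inv a \<otimes> x) -` A \<inter> space M) \<inter> carrier G"
    proof (intro equalityI subsetI)
      fix x assume "x \<in> (\<lambda>x. a \<otimes> x) ` A"
      then show "x \<in> ((\<lambda>x. inv a \<otimes> x) -` A \<inter> space M) \<inter> carrier G"
        using a sub by (auto simp: space subset_iff simp flip: m_assoc)
    next
      fix x assume "x \<in> ((\<lambda>x. inv a \<otimes> x) -` A \<inter> space M) \<inter> carrier G"
      then show "x \<in> (\<lambda>x. a \<otimes> x) ` A"
        using a by (intro image_eqI[of _ _ "inv a \<otimes> x"]) (auto simp flip: m_assoc)
    qed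
    have meas: "(\<lambda>x. inv a \<otimes> x) -` A \<inter> space M \<in> sets M"
      by (rule measurable_sets[OF translation(1)[OF ia] sub(2)])
    have "emeasure ?m ((\<lambda>x. a \<otimes> x) ` A) = emeasure M ((\<lambda>x. a \<otimes> x) ` A)"
      by (rule em) (use image in blast)
    also have "\<dots> = emeasure M ((\<lambda>x. inv a \<otimes> x) -` A \<inter> space M)"
      unfolding image by (rule emeasure_eq_AE) (use full meas C in auto)
    also have "\<dots> = emeasure (distr M M (\<lambda>x. inv a \<otimes> x)) A"
      by (rule emeasure_distr[OF translation(1)[OF ia] sub(2), symmetric])
    also have "\<dots> = emeasure ?m A" using em sub translation(2)[OF ia] by simp
    finally show ?thesis .
  qed
  have regular: "emeasure ?m A = (SUP K\<in>{K. K \<subseteq> A \<and> compact K}. emeasure ?m K)" if A: "A \<in> sets ?m" for A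
  proof -
    have "emeasure ?m A = emeasure M A" using A sets_iff em by auto
    also have "\<dots> = (SUP K\<in>{K. K \<subseteq> A \<and> compact K}. emeasure M K)"
      by (rule inner_regular) (use M A sets_iff in auto)
    also have "\<dots> = (SUP K\<in>{K. K \<subseteq> A \<and> compact K}. emeasure ?m K)"
      using A sets_iff em by (intro SUP_cong) auto
    finally show ?thesis .
  qed
  have "sets ?m = sets (restrict_space borel (carrier G))"
    using M(1) by (simp add: sets_restrict_space)
  then show ?thesis
    unfolding is_normalized_haar_def using trans regular em M(3) by auto
qed

subsection \<open>The circle\<close>

lemma carrier_circle [simp]: "carrier circle_group = sphere 0 1"
  and mult_circle [simp]: "monoid.mult circle_group = (*)"
  and one_circle [simp]: "one circle_group = 1"
  by (simp_all add: circle_group_def)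

lemma group_circle: "comm_group circle_group"
proof (rule comm_groupI)
  fix x assume "x \<in> carrier circle_group"
  then show "\<exists>y\<in>carrier circle_group. y \<otimes>\<^bsub>circle_group\<^esub> x = \<one>\<^bsub>circle_group\<^esub>"
    by (intro bexI[of _ "inverse x"]) (auto simp: norm_inverse intro!: left_inverse)
qed (auto simp: norm_mult)

lemma inv_circle: "z \<in> sphere 0 1 \<Longrightarrow> inv\<^bsub>circle_group\<^esub> z = inverse z"
  using comm_group.axioms(2)[OF group_circle]
  by (intro group.inv_equality) (auto simp: norm_inverse intro!: left_inverse)

lemma compact_abelian_group_circle: "compact_abelian_group circle_group"
proof -
  interpret comm_group circle_group by (rule group_circle)
  show ?thesis
  proof
    show "continuous_on (carrier circle_group \<times> carrier circle_group) (\<lambda>(x, y). x \<otimes>\<^bsub>circle_group\<^esub> y)"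
      by (simp add: split_beta') (intro continuous_intros)
    have "continuous_on (sphere (0::complex) 1) (\<lambda>x. inverse x)"
      by (intro continuous_intros) auto
    moreover have "continuous_on (sphere 0 1) (\<lambda>x. inv\<^bsub>circle_group\<^esub> x) \<longleftrightarrow> continuous_on (sphere (0::complex) 1) inverse"
      by (intro continuous_on_cong) (auto simp: inv_circle)
    ultimately show "continuous_on (carrier circle_group) (\<lambda>x. inv\<^bsub>circle_group\<^esub> x)" by simp
  qed simp
qed

definition circle_measure :: "complex measure" where
  "circle_measure = distr (uniform_measure lborel {0..<2 * pi}) borel cis"

lemma cis_measurable [measurable]: "cis \<in> borel_measurable borel"
  by (intro borel_measurable_continuous_onI continuous_on_cis continuous_on_id)

lemma prob_space_circle_measure: "prob_space circle_measure"
  unfolding circle_measure_def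
  by (intro prob_space.prob_space_distr prob_space_uniform_measure)
     (auto simp: measurable_cong_sets[OF sets_uniform_measure refl])

lemma sets_circle_measure [simp, measurable_cong]: "sets circle_measure = sets borel"
  and space_circle_measure [simp]: "space circle_measure = UNIV"
  by (simp_all add: circle_measure_def)

lemma emeasure_circle_measure:
  assumes "A \<in> sets borel"
  shows "emeasure circle_measure A = emeasure lborel (cis -` A \<inter> {0..<2 * pi}) / ennreal (2 * pi)"
proof -
  have "cis -` A \<in> sets borel" using measurable_sets[OF cis_measurable assms] by simp
  then show ?thesis
    using assms unfolding circle_measure_def
    by (subst emeasure_distr) (auto simp: measurable_cong_sets[OF sets_uniform_measure refl] Int_commute)
qed

lemma emeasure_circle_measure_sphere: "emeasure circle_measure (sphere 0 1) = 1"
proof -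
  have "cis -` sphere 0 1 = UNIV" by auto
  moreover have "ennreal (2 * pi) / ennreal (2 * pi) = 1"
    by (rule ennreal_divide_self) auto
  ultimately show ?thesis
    by (subst emeasure_circle_measure) auto
qed

lemma emeasure_lborel_translate:
  assumes "X \<in> sets borel"
  shows "emeasure lborel ((\<lambda>t::real. c + t) -` X) = emeasure lborel X"
proof -
  have "emeasure lborel X = emeasure (distr lborel borel ((+) c)) X"
    by (simp add: lborel_distr_plus)
  also have "\<dots> = emeasure lborel ((\<lambda>t. c + t) -` X)"
    using assms by (subst emeasure_distr) auto
  finally show ?thesis ..
qed

text \<open>The translated window from \<open>s\<close> to \<open>2 pi + s\<close> is cut at
  \<open>2 pi\<close>, and periodicity moves the overhanging piece back to the beginning.\<close>

lemma emeasure_periodic_translate: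
  fixes B :: "real set"
  assumes B: "B \<in> sets borel" and periodic: "\<And>t. 2 * pi + t \<in> B \<longleftrightarrow> t \<in> B" and s: "0 \<le> s" "s < 2 * pi"
  shows "emeasure lborel ((\<lambda>t. s + t) -` B \<inter> {0..<2 * pi}) = emeasure lborel (B \<inter> {0..<2 * pi})"
proof -
  have "(\<lambda>t. s + t) -` B \<inter> {0..<2 * pi} = (\<lambda>t. s + t) -` (B \<inter> {s..<2 * pi + s})"
    by auto
  moreover have "B \<inter> {s..<2 * pi + s} \<in> sets borel" using B by simp
  ultimately have "emeasure lborel ((\<lambda>t. s + t) -` B \<inter> {0..<2 * pi}) = emeasure lborel (B \<inter> {s..<2 * pi + s})"
    by (simp only: emeasure_lborel_translate)
  also have "B \<inter> {s..<2 * pi + s} = (B \<inter> {s..<2 * pi}) \<union> (B \<inter> {2 * pi..<2 * pi + s})"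
    using s by auto
  also have "emeasure lborel \<dots> = emeasure lborel (B \<inter> {s..<2 * pi}) + emeasure lborel (B \<inter> {2 * pi..<2 * pi + s})"
    using B by (intro plus_emeasure[symmetric]) auto
  also have "emeasure lborel (B \<inter> {2 * pi..<2 * pi + s}) = emeasure lborel ((\<lambda>t. 2 * pi + t) -` (B \<inter> {2 * pi..<2 * pi + s}))"
    using B by (intro emeasure_lborel_translate[symmetric]) auto
  also have "(\<lambda>t. 2 * pi + t) -` (B \<inter> {2 * pi..<2 * pi + s}) = B \<inter> {0..<s}"
    using periodic by auto
  also have "emeasure lborel (B \<inter> {s..<2 * pi}) + emeasure lborel (B \<inter> {0..<s}) = emeasure lborel ((B \<inter> {s..<2 * pi}) \<union> (B \<inter> {0..<s}))"
    using B by (intro plus_emeasure) auto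
  also have "(B \<inter> {s..<2 * pi}) \<union> (B \<inter> {0..<s}) = B \<inter> {0..<2 * pi}"
    using s by auto
  finally show ?thesis .
qed

lemma emeasure_circle_measure_rotate:
  assumes a: "a \<in> sphere 0 1" and A: "A \<in> sets borel"
  shows "emeasure circle_measure ((\<lambda>z. a * z) -` A) = emeasure circle_measure A"
proof -
  have "norm a = 1" using a by simp
  then obtain s where s: "0 \<le> s" "s < 2 * pi" "a = Complex (cos s) (sin s)"
    by (rule complex_unimodular_polar)
  then have a_eq: "a = cis s" by (simp add: complex_eq_iff)
  have meas: "(\<lambda>z. a * z) -` A \<in> sets borel"
    using measurable_sets[of "\<lambda>z. a * z" borel borel A] A by simp
  have B: "cis -` A \<in> sets borel" using measurable_sets[OF cis_measurable A] by simp
  have "cis -` ((\<lambda>z. a * z) -` A) = (\<lambda>t. s + t) -` (cis -` A)"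
    by (auto simp: a_eq cis_mult)
  moreover have "2 * pi + t \<in> cis -` A \<longleftrightarrow> t \<in> cis -` A" for t
    by (simp flip: cis_mult)
  ultimately show ?thesis
    using emeasure_periodic_translate[OF B _ s(1,2)]
    by (simp only: emeasure_circle_measure[OF meas] emeasure_circle_measure[OF A])
qed

lemma circle_has_haar: "is_normalized_haar circle_group (haar_measure circle_group)"
proof (rule is_normalized_haar_haar_measure[OF compact_abelian_group_circle is_normalized_haar_restrict_space[OF compact_abelian_group_circle]])
  fix a assume "a \<in> carrier circle_group"
  then have a: "a \<in> sphere 0 1" by simp
  have meas: "(\<lambda>x. a * x) \<in> measurable circle_measure circle_measure"
    unfolding measurable_cong_sets[OF sets_circle_measure sets_circle_measure] by measurable
  then show "(\<lambda>x. a \<otimes>\<^bsub>circle_group\<^esub> x) \<in> measurable circle_measure circle_measure" by simp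
  show "distr circle_measure circle_measure (\<lambda>x. a \<otimes>\<^bsub>circle_group\<^esub> x) = circle_measure"
    by (rule measure_eqI) (use meas emeasure_circle_measure_rotate[OF a] in \<open>auto simp: emeasure_distr\<close>)
qed (auto simp: prob_space_circle_measure emeasure_circle_measure_sphere)

lemma lambda_dirichlet_group_circle: "lambda_dirichlet_group (\<lambda>n. real n) circle_group \<beta>_circle"
proof -
  interpret compact_abelian_group circle_group by (rule compact_abelian_group_circle)
  have \<beta>: "\<beta>_circle t = cis (- t)" for t by (simp add: \<beta>_circle_def cis_conv_exp)
  show ?thesis
  proof
    show "\<beta>_circle t \<in> carrier circle_group" for t by (simp add: \<beta>)
    show "\<beta>_circle (s + t) = \<beta>_circle s \<otimes>\<^bsub>circle_group\<^esub> \<beta>_circle t" for s t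
      by (simp add: \<beta> cis_mult)
    show "continuous_on UNIV \<beta>_circle"
      unfolding \<beta>_circle_def[abs_def] by (intro continuous_intros)
    show "carrier circle_group \<subseteq> closure (range \<beta>_circle)"
    proof
      fix z assume "z \<in> carrier circle_group"
      then have z: "norm z = 1" by simp
      then have "z \<noteq> 0" by auto
      then have "z = \<beta>_circle (- Arg z)"
        using cis_Arg[of z] z by (simp add: \<beta> sgn_eq)
      then have "z \<in> range \<beta>_circle" by (rule range_eqI)
      then show "z \<in> closure (range \<beta>_circle)" by (rule subsetD[OF closure_subset])
    qed
    fix n
    have "restrict (\<lambda>x. x ^ n) (carrier circle_group) \<in> characters circle_group"
      by (rule restrict_in_characters) (auto simp: norm_power power_mult_distrib intro!: continuous_intros)
    moreover have "represents_frequency \<beta>_circle (real n) (restrict (\<lambda>x. x ^ n) (carrier circle_group))"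
      by (simp add: represents_frequency_def \<beta> Complex.DeMoivre) (simp add: cis_conv_exp mult.assoc)
    ultimately show "\<exists>\<gamma>\<in>characters circle_group. represents_frequency \<beta>_circle (real n) \<gamma>" by blast
  qed
qed

lemma frequency_nat: "frequency (\<lambda>n. real n)"
  unfolding frequency_def by (auto simp: strict_mono_def bdd_above_def not_le intro: reals_Archimedean2)

subsection \<open>The infinite torus\<close>

lemma carrier_torus [simp]: "carrier torus_group = (UNIV \<rightarrow>\<^sub>E sphere 0 1)"
  by (simp add: torus_group_def)

lemma mult_torus [simp]: "x \<otimes>\<^bsub>torus_group\<^esub> y = (\<lambda>i. x i * y i)"
  by (simp add: torus_group_def restrict_def)

lemma group_circle': "group circle_group"
  using group_circle by (rule comm_group.axioms)

lemma group_torus: "comm_group torus_group"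
proof (rule group.group_comm_groupI)
  show "group torus_group" by (simp add: torus_group_def group_circle')
qed (simp add: mult.commute)

lemma inv_torus:
  assumes "x \<in> carrier torus_group"
  shows "inv\<^bsub>torus_group\<^esub> x = (\<lambda>i. inverse (x i))"
  using assms inv_product_group[of x UNIV "\<lambda>_. circle_group"] group_circle'
  by (auto simp: torus_group_def inv_circle PiE_iff)

lemma compact_abelian_group_torus: "compact_abelian_group torus_group"
proof -
  interpret comm_group torus_group by (rule group_torus)
  show ?thesis
  proof
    have "compactin (product_topology (\<lambda>_::nat. euclidean) UNIV) (UNIV \<rightarrow>\<^sub>E sphere (0::complex) 1)"
      by (simp add: compactin_PiE)
    then show "compact (carrier torus_group)"
      by (simp add: euclidean_product_topology)
    have "continuous_on A (\<lambda>p :: (nat \<Rightarrow> complex) \<times> (nat \<Rightarrow> complex). \<lambda>i. fst p i * snd p i)" for A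
      by (intro continuous_on_coordinatewise_then_product continuous_on_mult
        continuous_on_product_then_coordinatewise[OF continuous_on_fst[OF continuous_on_id]]
        continuous_on_product_then_coordinatewise[OF continuous_on_snd[OF continuous_on_id]])
    then show "continuous_on (carrier torus_group \<times> carrier torus_group) (\<lambda>(x, y). x \<otimes>\<^bsub>torus_group\<^esub> y)"
      by (simp add: split_beta')
    have "continuous_on (carrier torus_group) (\<lambda>x. \<lambda>i. inverse (x i))"
    proof (intro continuous_on_coordinatewise_then_product continuous_on_inverse)
      fix i
      show "continuous_on (carrier torus_group) (\<lambda>x. x i)"
        by (rule continuous_on_product_then_coordinatewise[OF continuous_on_id])
      show "\<forall>x\<in>carrier torus_group. x i \<noteq> 0"
      proof
        fix x assume "x \<in> carrier torus_group"
        then have "norm (x i) = 1" by (simp add: PiE_iff)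
        then show "x i \<noteq> 0" by auto
      qed
    qed
    moreover have "continuous_on (carrier torus_group) (\<lambda>x. inv\<^bsub>torus_group\<^esub> x) \<longleftrightarrow>
        continuous_on (carrier torus_group) (\<lambda>x. \<lambda>i. inverse (x i))"
      by (rule continuous_on_cong) (auto simp: inv_torus)
    ultimately show "continuous_on (carrier torus_group) (\<lambda>x. inv\<^bsub>torus_group\<^esub> x)" by simp
  qed
qed

definition torus_measure :: "(nat \<Rightarrow> complex) measure" where
  "torus_measure = PiM UNIV (\<lambda>_. circle_measure)"

text \<open>For countably many second countable factors the product sigma-algebra is the Borel
  sigma-algebra of the product topology.\<close>

lemma sets_torus_measure [measurable_cong]: "sets torus_measure = sets borel"
proof -
  have "sets torus_measure = sets (PiM UNIV (\<lambda>_::nat. borel :: complex measure))"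
    unfolding torus_measure_def by (intro sets_PiM_cong) auto
  then show ?thesis by (simp only: sets_PiM_equal_borel)
qed

lemma prob_space_torus_measure: "prob_space torus_measure"
  unfolding torus_measure_def by (intro prob_space_PiM prob_space_circle_measure)

lemma space_torus_measure [simp]: "space torus_measure = UNIV"
  by (simp add: torus_measure_def space_PiM)

text \<open>Membership in the carrier is a countable conjunction of conditions on single
  coordinates, each of which holds almost everywhere.\<close>

lemma emeasure_torus_measure_carrier: "emeasure torus_measure (carrier torus_group) = 1"
proof -
  interpret prob_space torus_measure by (rule prob_space_torus_measure)
  interpret circle: prob_space circle_measure by (rule prob_space_circle_measure)
  have closed: "closed (carrier torus_group)"
    using compact_abelian_group.compact_carrier[OF compact_abelian_group_torus] by (rule compact_imp_closed)
  have "circle.prob (sphere 0 1) = 1"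
    by (simp add: measure_def emeasure_circle_measure_sphere)
  then have "AE z in circle_measure. z \<in> sphere 0 1"
    by (subst (asm) circle.prob_eq_1) simp_all
  then have "AE x in torus_measure. x i \<in> sphere 0 1" for i
    unfolding torus_measure_def
    by (intro AE_PiM_component[of UNIV "\<lambda>_. circle_measure"] prob_space_circle_measure) auto
  then have "AE x in torus_measure. \<forall>i. x i \<in> sphere 0 1" unfolding AE_all_countable by (rule allI)
  then have "AE x in torus_measure. x \<in> carrier torus_group"
    by eventually_elim auto
  moreover have "carrier torus_group \<in> sets torus_measure"
    using borel_closed[OF closed] by (simp only: sets_torus_measure)
  ultimately show ?thesis
    using AE_iff_emeasure_eq_1[of "\<lambda>x. x \<in> carrier torus_group"] by simp
qed

lemma measurable_torus_translation:
  "(\<lambda>x i. a i * x i) \<in> measurable torus_measure torus_measure"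
proof -
  have "(\<lambda>z. a i * z) \<in> measurable circle_measure circle_measure" for i
    unfolding measurable_cong_sets[OF sets_circle_measure sets_circle_measure] by measurable
  then show ?thesis
    unfolding torus_measure_def
    by (intro measurable_PiM_single') (auto intro!: measurable_compose[OF measurable_component_singleton])
qed

text \<open>The product measure is determined by its values on finite cylinders. There a translation
  acts on each coordinate separately, as a rotation of the circle.\<close>

lemma distr_torus_translation:
  assumes a: "a \<in> carrier torus_group"
  shows "distr torus_measure torus_measure (\<lambda>x i. a i * x i) = torus_measure"
proof -
  interpret circle: prob_space circle_measure by (rule prob_space_circle_measure)
  interpret product_prob_space "\<lambda>_::nat. circle_measure" UNIV by unfold_locales
  let ?D = "distr torus_measure torus_measure (\<lambda>x i. a i * x i)"
  have "?D = PiM UNIV (\<lambda>_. circle_measure)"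
  proof (rule PiM_eq)
    show "sets ?D = sets (PiM UNIV (\<lambda>_. circle_measure))" by (simp add: torus_measure_def)
    fix J :: "nat set" and F assume J: "finite J" and F: "\<And>j. j \<in> J \<Longrightarrow> F j \<in> sets circle_measure"
    let ?E = "prod_emb UNIV (\<lambda>_. circle_measure) J (\<Pi>\<^sub>E j\<in>J. F j)"
    have E: "?E = {x. \<forall>j\<in>J. x j \<in> F j}" by (auto simp: prod_emb_def PiE_iff)
    have "?E \<in> sets torus_measure"
      unfolding torus_measure_def using F J by (intro sets_PiM_I) auto
    then have "emeasure ?D ?E = emeasure torus_measure ((\<lambda>x i. a i * x i) -` ?E \<inter> space torus_measure)"
      by (rule emeasure_distr[OF measurable_torus_translation])
    also have "(\<lambda>x i. a i * x i) -` ?E \<inter> space torus_measure =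
        {x \<in> space (PiM UNIV (\<lambda>_. circle_measure)). \<forall>j\<in>J. x j \<in> (\<lambda>z. a j * z) -` F j}"
      by (auto simp: E space_PiM)
    also have "emeasure torus_measure \<dots> = (\<Prod>j\<in>J. emeasure circle_measure ((\<lambda>z. a j * z) -` F j))"
      unfolding torus_measure_def
    proof (rule emeasure_PiM_Collect)
      show "(\<lambda>z. a j * z) -` F j \<in> sets circle_measure" if "j \<in> J" for j
        using measurable_sets[of "\<lambda>z. a j * z" borel borel "F j"] F[OF that] by simp
    qed (use J in auto)
    also have "\<dots> = (\<Prod>j\<in>J. emeasure circle_measure (F j))"
      using F a by (intro prod.cong refl emeasure_circle_measure_rotate) auto
    finally show "emeasure ?D ?E = (\<Prod>j\<in>J. emeasure circle_measure (F j))" .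
  qed
  then show ?thesis by (simp only: torus_measure_def)
qed

lemma torus_has_haar: "is_normalized_haar torus_group (haar_measure torus_group)"
proof (rule is_normalized_haar_haar_measure[OF compact_abelian_group_torus is_normalized_haar_restrict_space[OF compact_abelian_group_torus]])
  fix a assume a: "a \<in> carrier torus_group"
  show "(\<lambda>x. a \<otimes>\<^bsub>torus_group\<^esub> x) \<in> measurable torus_measure torus_measure"
    unfolding mult_torus by (rule measurable_torus_translation)
  show "distr torus_measure torus_measure (\<lambda>x. a \<otimes>\<^bsub>torus_group\<^esub> x) = torus_measure"
    unfolding mult_torus by (rule distr_torus_translation[OF a])
qed (rule sets_torus_measure prob_space_torus_measure emeasure_torus_measure_carrier)+

section \<open>Density of the prime flow by Kronecker's theorem, and the monomial characters\<close>

lemma prime_nth_prime: "prime (nth_prime k)"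
  using enumerate_in_set[OF primes_infinite, of k] by (simp add: nth_prime_def)

lemma inj_nth_prime: "inj nth_prime"
  using strict_mono_imp_inj_on[OF strict_mono_enumerate[OF primes_infinite]]
  by (simp add: nth_prime_def[abs_def])

lemma ex_nth_prime: "prime p \<Longrightarrow> \<exists>k. nth_prime k = p"
  using enumerate_Ex[OF primes_infinite, of p] by (auto simp: nth_prime_def)

lemma \<beta>_torus_eq: "\<beta>_torus t k = cis (- (ln (real (nth_prime k)) * t))"
proof -
  have "nth_prime k > 0" using prime_nth_prime prime_gt_0_nat by blast
  then have "Ln (of_nat (nth_prime k)) = of_real (ln (real (nth_prime k)))"
    by (metis Ln_of_real of_nat_0_less_iff of_real_of_nat_eq)
  then show ?thesis
    using \<open>nth_prime k > 0\<close> by (simp add: \<beta>_torus_def powr_def cis_conv_exp mult_ac)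
qed

text \<open>Unique factorization: after exponentiation the relation equates two products of prime
  powers, whose multiplicities can be compared.\<close>

lemma log_primes_independent:
  fixes m :: "nat \<Rightarrow> int"
  assumes "finite J" "(\<Sum>j\<in>J. real_of_int (m j) * ln (real (nth_prime j))) = 0" "i \<in> J"
  shows "m i = 0"
proof -
  let ?p = "\<lambda>j. nth_prime j"
  have p0: "?p j > 0" for j using prime_nth_prime prime_gt_0_nat by blast
  \<comment> \<open>Since \<open>nat\<close> truncates negative numbers to 0, \<open>N 1\<close>
    collects the positive exponents and \<open>N (-1)\<close> the negative ones.\<close>
  define N where "N s = (\<Prod>j\<in>J. ?p j ^ nat (s * m j))" for s :: int
  have N0: "N s > 0" for s unfolding N_def using p0 by (intro prod_pos) auto
  have ln_N: "ln (real (N s)) = (\<Sum>j\<in>J. real (nat (s * m j)) * ln (real (?p j)))" for s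
    unfolding N_def using p0 assms(1) by (simp add: ln_prod ln_realpow)
  have "ln (real (N 1)) - ln (real (N (-1))) = (\<Sum>j\<in>J. real_of_int (m j) * ln (real (?p j)))"
  proof -
    have "real (nat (1 * k)) - real (nat (-1 * k)) = real_of_int k" for k by auto
    then show ?thesis
      unfolding ln_N sum_subtractf[symmetric] left_diff_distrib[symmetric] by (simp only:)
  qed
  then have "N 1 = N (-1)" using N0[of 1] N0[of "-1"] assms(2) by simp
  moreover have "multiplicity (?p i) (N s) = nat (s * m i)" for s
  proof -
    have "N s = (\<Prod>q\<in>?p ` J. q ^ nat (s * m (inv_into UNIV nth_prime q)))"
      unfolding N_def using inj_nth_prime
      by (subst prod.reindex) (auto simp: inv_f_f intro: inj_on_subset)
    also have "multiplicity (?p i) \<dots> = nat (s * m i)"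
      using assms(1,3) prime_nth_prime by (subst multiplicity_prod_prime_powers) (auto simp: inv_f_f[OF inj_nth_prime])
    finally show ?thesis .
  qed
  ultimately have "nat (1 * m i) = nat (-1 * m i)" by metis
  then show ?thesis by simp
qed

text \<open>Kronecker's theorem for the logarithms of the first \<open>n\<close> primes, measured in
  full turns; the integers it provides are full turns and disappear under
  \<open>cis\<close>.\<close>

lemma \<beta>_torus_approx:
  assumes x: "x \<in> carrier torus_group" and "\<epsilon> > 0"
  shows "\<exists>t. \<forall>i<n. norm (\<beta>_torus t i - x i) < \<epsilon>"
proof -
  define \<theta> where "\<theta> k = ln (real (nth_prime k)) / (2 * pi)" for k
  \<comment> \<open>The sign compensates the minus in the exponent of
    \<open>\<beta>_torus\<close>.\<close>
  define \<alpha> where "\<alpha> k = - Arg (x k) / (2 * pi)" for k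
  have p1: "real (nth_prime k) > 1" for k
    using prime_gt_1_nat[OF prime_nth_prime[of k]] by simp
  have "inj \<theta>"
  proof (rule injI)
    fix i j assume "\<theta> i = \<theta> j"
    then have "ln (real (nth_prime i)) = ln (real (nth_prime j))" by (simp add: \<theta>_def)
    then have "nth_prime i = nth_prime j" using p1[of i] p1[of j] by simp
    then show "i = j" using inj_nth_prime by (simp add: inj_eq)
  qed
  have module: "Modules.module (\<lambda>r. (*) (real_of_int r))"
    by (simp add: Modules.module.intro distrib_left mult.commute)
  have indep: "module.independent (\<lambda>r. (*) (real_of_int r)) (\<theta> ` {..<n})"
    unfolding module.independent_explicit_module[OF module]
  proof (intro allI impI)
    fix T u v assume T: "finite T" "T \<subseteq> \<theta> ` {..<n}" "(\<Sum>v\<in>T. real_of_int (u v) * v) = 0" "v \<in> T"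
    obtain J where J: "J \<subseteq> {..<n}" "T = \<theta> ` J" using T(2) by (meson subset_imageE)
    obtain i where i: "i \<in> J" "v = \<theta> i" using T(4) J by auto
    have "finite J" using J(1) by (rule finite_subset) simp
    have "(\<Sum>v\<in>T. real_of_int (u v) * v) = (\<Sum>j\<in>J. real_of_int (u (\<theta> j)) * \<theta> j)"
      unfolding J(2) using \<open>inj \<theta>\<close> by (subst sum.reindex) (auto intro: inj_on_subset)
    also have "\<dots> = (\<Sum>j\<in>J. real_of_int (u (\<theta> j)) * ln (real (nth_prime j))) / (2 * pi)"
      by (simp add: \<theta>_def sum_divide_distrib)
    finally have "(\<Sum>j\<in>J. real_of_int (u (\<theta> j)) * ln (real (nth_prime j))) = 0" using T(3) by simp
    from log_primes_independent[OF \<open>finite J\<close> this i(1)] show "u v = 0" by (simp add: i)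
  qed
  have inj: "inj_on \<theta> {..<n}" using \<open>inj \<theta>\<close> by (rule inj_on_subset) simp
  have pos: "\<epsilon> / (2 * pi) > 0" using \<open>\<epsilon> > 0\<close> by simp
  obtain t k where tk: "\<And>i. i < n \<Longrightarrow> \<bar>t * \<theta> i - of_int (k i) - \<alpha> i\<bar> < \<epsilon> / (2 * pi)"
    using Kronecker_thm_1[where \<alpha> = \<alpha>, OF indep inj pos] by blast
  have "norm (\<beta>_torus t i - x i) < \<epsilon>" if "i < n" for i
  proof -
    let ?\<delta> = "t * \<theta> i - of_int (k i) - \<alpha> i"
    have "norm (x i) = 1" using x by (simp add: PiE_iff)
    then have "x i \<noteq> 0" by auto
    then have xi: "x i = cis (Arg (x i))" using cis_Arg[of "x i"] \<open>norm (x i) = 1\<close> by (simp add: sgn_eq)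
    have "- (ln (real (nth_prime i)) * t) = Arg (x i) + 2 * pi * of_int (- k i) + - (2 * pi * ?\<delta>)"
      by (simp add: \<theta>_def \<alpha>_def field_simps)
    then have "\<beta>_torus t i = cis (Arg (x i)) * cis (2 * pi * of_int (- k i)) * cis (- (2 * pi * ?\<delta>))"
      by (simp only: \<beta>_torus_eq cis_mult)
    also have "cis (2 * pi * of_int (- k i)) = 1" by (rule cis_multiple_2pi) simp
    finally have "\<beta>_torus t i - x i = x i * (cis (- (2 * pi * ?\<delta>)) - 1)"
      using xi by (simp add: right_diff_distrib)
    then have "norm (\<beta>_torus t i - x i) = norm (cis (- (2 * pi * ?\<delta>)) - 1)"
      using \<open>norm (x i) = 1\<close> by (simp add: norm_mult)
    also have "\<dots> \<le> 2 * pi * \<bar>?\<delta>\<bar>"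
      using norm_cis_diff_1_le[of "- (2 * pi * ?\<delta>)"] by (simp add: abs_mult)
    also have "\<dots> < \<epsilon>" using tk[OF that] by (simp add: pos_less_divide_eq mult.commute)
    finally show ?thesis .
  qed
  then show ?thesis by blast
qed

text \<open>The \<open>n\<close>-th time matches the first \<open>n\<close> coordinates up to
  \<open>1 / (n + 1)\<close>, so one sequence of times works for every coordinate, which is
  convergence in the product topology.\<close>

lemma \<beta>_torus_dense: "carrier torus_group \<subseteq> closure (range \<beta>_torus)"
proof
  fix x assume x: "x \<in> carrier torus_group"
  have "\<forall>n. \<exists>t. \<forall>i<n. norm (\<beta>_torus t i - x i) < 1 / real (Suc n)"
    using \<beta>_torus_approx[OF x] by simp
  then obtain t where t: "\<And>n i. i < n \<Longrightarrow> norm (\<beta>_torus (t n) i - x i) < 1 / real (Suc n)" by metis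
  have coord: "(\<lambda>n. \<beta>_torus (t n) i) \<longlonglongrightarrow> x i" for i
  proof (rule LIM_zero_cancel, rule Lim_null_comparison)
    show "\<forall>\<^sub>F n in sequentially. norm (\<beta>_torus (t n) i - x i) \<le> 1 / real (Suc n)"
      using eventually_gt_at_top[of i] by eventually_elim (use t in \<open>simp add: less_imp_le\<close>)
    show "(\<lambda>n. 1 / real (Suc n)) \<longlonglongrightarrow> 0" by (rule LIMSEQ_Suc[OF lim_1_over_n])
  qed
  have "limitin (product_topology (\<lambda>_::nat. euclidean) UNIV) (\<lambda>n. \<beta>_torus (t n)) x sequentially"
    using coord by (simp add: limitin_componentwise)
  then have "(\<lambda>n. \<beta>_torus (t n)) \<longlonglongrightarrow> x" by (simp add: euclidean_product_topology)
  then show "x \<in> closure (range \<beta>_torus)"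
    unfolding closure_sequential by (intro exI[of _ "\<lambda>n. \<beta>_torus (t n)"]) simp
qed

text \<open>Induction on the prime factorization: a prime factor with index \<open>k\<close>
  multiplies the character by the \<open>k\<close>-th coordinate, and the result is the monomial
  with the exponents of \<open>N\<close>.\<close>

lemma torus_character_exists:
  assumes "N > 0"
  shows "\<exists>\<gamma>\<in>characters torus_group. represents_frequency \<beta>_torus (ln (real N)) \<gamma>"
proof -
  interpret compact_abelian_group torus_group by (rule compact_abelian_group_torus)
  have \<beta>_in: "\<beta>_torus t \<in> carrier torus_group" for t by (simp add: \<beta>_torus_eq PiE_iff)
  have norm1: "norm (x k) = 1" if "x \<in> carrier torus_group" for x k using that by (simp add: PiE_iff)
  show ?thesis using assms
  proof (induction N rule: prime_divisors_induct)
    case (unit N)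
    have "restrict (\<lambda>_. 1) (carrier torus_group) \<in> characters torus_group"
      by (rule restrict_in_characters) auto
    moreover have "represents_frequency \<beta>_torus (ln (real N)) (restrict (\<lambda>_. 1) (carrier torus_group))"
      using unit \<beta>_in by (simp add: represents_frequency_def del: carrier_torus)
    ultimately show ?case by blast
  next
    case (factor p N)
    then have "N > 0" by simp
    with factor obtain \<gamma> where \<gamma>: "\<gamma> \<in> characters torus_group" "represents_frequency \<beta>_torus (ln (real N)) \<gamma>"
      by blast
    obtain k where k: "nth_prime k = p" using ex_nth_prime factor by blast
    have \<gamma>': "continuous_on (carrier torus_group) \<gamma>" "\<And>x. x \<in> carrier torus_group \<Longrightarrow> norm (\<gamma> x) = 1"
      "\<And>x y. x \<in> carrier torus_group \<Longrightarrow> y \<in> carrier torus_group \<Longrightarrow> \<gamma> (x \<otimes>\<^bsub>torus_group\<^esub> y) = \<gamma> x * \<gamma> y"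
      using \<gamma>(1) by (force simp: characters_def hom_def simp del: carrier_torus mult_torus)+
    have "restrict (\<lambda>x. x k * \<gamma> x) (carrier torus_group) \<in> characters torus_group"
    proof (rule restrict_in_characters)
      show "continuous_on (carrier torus_group) (\<lambda>x. x k * \<gamma> x)"
        by (intro continuous_on_mult \<gamma>' continuous_on_product_then_coordinatewise[OF continuous_on_id])
      show "norm (x k * \<gamma> x) = 1" if "x \<in> carrier torus_group" for x
        using \<gamma>'(2)[OF that] norm1[OF that] by (simp add: norm_mult)
      show "(x \<otimes>\<^bsub>torus_group\<^esub> y) k * \<gamma> (x \<otimes>\<^bsub>torus_group\<^esub> y) = x k * \<gamma> x * (y k * \<gamma> y)"
        if "x \<in> carrier torus_group" "y \<in> carrier torus_group" for x y
        unfolding \<gamma>'(3)[OF that] by simp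
    qed
    moreover have "represents_frequency \<beta>_torus (ln (real (p * N))) (restrict (\<lambda>x. x k * \<gamma> x) (carrier torus_group))"
    proof -
      have "p > 0" using factor by auto
      then have "ln (real (p * N)) = ln (real p) + ln (real N)" using \<open>N > 0\<close> by (simp add: ln_mult)
      then show ?thesis
        using \<gamma>(2) \<beta>_in
        by (simp add: represents_frequency_def \<beta>_torus_eq k cis_conv_exp algebra_simps flip: exp_add del: carrier_torus)
    qed
    ultimately show ?case by blast
  qed simp
qed

lemma lambda_dirichlet_group_torus: "lambda_dirichlet_group (\<lambda>n. ln (real (Suc n))) torus_group \<beta>_torus"
proof -
  interpret compact_abelian_group torus_group by (rule compact_abelian_group_torus)
  show ?thesis
  proof
    show "\<beta>_torus t \<in> carrier torus_group" for t by (simp add: \<beta>_torus_eq PiE_iff)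
    show "\<beta>_torus (s + t) = \<beta>_torus s \<otimes>\<^bsub>torus_group\<^esub> \<beta>_torus t" for s t
      by (rule ext) (simp add: \<beta>_torus_eq cis_mult algebra_simps)
    show "continuous_on UNIV \<beta>_torus"
    proof (rule continuous_on_coordinatewise_then_product)
      show "continuous_on UNIV (\<lambda>t. \<beta>_torus t i)" for i
        unfolding \<beta>_torus_eq by (intro continuous_intros)
    qed
    show "carrier torus_group \<subseteq> closure (range \<beta>_torus)" by (rule \<beta>_torus_dense)
    show "\<exists>\<gamma>\<in>characters torus_group. represents_frequency \<beta>_torus (ln (real (Suc n))) \<gamma>" for n
      by (rule torus_character_exists) simp
  qed
qed

lemma frequency_log: "frequency (\<lambda>n. ln (real (Suc n)))"
proof -
  have "\<exists>n. M < ln (real (Suc n))" for M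
  proof -
    obtain n where "exp M < real n" using reals_Archimedean2 by blast
    then have "exp M < real (Suc n)" by simp
    then have "ln (exp M) < ln (real (Suc n))" by (subst ln_less_cancel_iff) simp_all
    then show ?thesis by auto
  qed
  then show ?thesis
    unfolding frequency_def by (auto simp: strict_mono_def bdd_above_def not_le)
qed

theorem mainTheorem8:
  shows
    "(frequency (\<lambda>n. real n) \<and>
      lambda_dirichlet_group (\<lambda>n. real n) circle_group \<beta>_circle \<and>
      (\<exists>f\<in>hardy_H1 (\<lambda>n. real n) circle_group \<beta>_circle.
         \<not> (AE \<omega> in haar_measure circle_group.
              riesz_summable_at (\<lambda>n. real n) circle_group \<beta>_circle f \<omega>))) \<and>
     (frequency (\<lambda>n. ln (real (Suc n))) \<and>
      lambda_dirichlet_group (\<lambda>n. ln (real (Suc n))) torus_group \<beta>_torus \<and>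
      (\<exists>f\<in>hardy_H1 (\<lambda>n. ln (real (Suc n))) torus_group \<beta>_torus.
         \<not> (AE \<omega> in haar_measure torus_group.
              riesz_summable_at (\<lambda>n. ln (real (Suc n))) torus_group \<beta>_torus f \<omega>)))"
proof (intro conjI)
  show "\<exists>f\<in>hardy_H1 (\<lambda>n. real n) circle_group \<beta>_circle.
      \<not> (AE \<omega> in haar_measure circle_group. riesz_summable_at (\<lambda>n. real n) circle_group \<beta>_circle f \<omega>)"
    by (rule ex_not_riesz_summable[OF lambda_dirichlet_group_circle frequency_nat circle_has_haar, of 1]) auto
  \<comment> \<open>The progression consists of the logarithms of the powers of 2; the index is one
    less because the frequencies start with \<open>ln 1\<close> at index 0.\<close>
  have "\<exists>n. ln (real (Suc n)) = real k * ln 2" for k :: nat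
    by (rule exI[of _ "2 ^ k - 1"]) (simp add: ln_realpow)
  then show "\<exists>f\<in>hardy_H1 (\<lambda>n. ln (real (Suc n))) torus_group \<beta>_torus.
      \<not> (AE \<omega> in haar_measure torus_group. riesz_summable_at (\<lambda>n. ln (real (Suc n))) torus_group \<beta>_torus f \<omega>)"
    by (intro ex_not_riesz_summable[OF lambda_dirichlet_group_torus frequency_log torus_has_haar, of "ln 2"]) auto
qed (rule frequency_nat lambda_dirichlet_group_circle frequency_log lambda_dirichlet_group_torus)+

end
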